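(* Let $r,d\in\mathbb{N}$. There exists a deterministic algorithm which, given a word $w\in F(X_r)$, decides whether $w=1$ in the free solvable group $S_{r,d}$, in quasi-quadratic time $\tilde O(|w|^2)$.
   Context: $F=F(X_r)$ is the free group with basis $X_r=\{x_1,\dots,x_r\}$; elements are given as words over $X_r^{\pm}=\{x_1^{\pm1},\dots,x_r^{\pm1}\}$ and $|w|$ denotes word length. Put $F^{(0)}=F$, $F^{(i)}=[F^{(i-1)},F^{(i-1)}]$; the free solvable group of rank $r$ and class $d$ is $S_{r,d}=F/F^{(d)}$ (so $S_{r,0}$ is trivial and $S_{r,1}$ is free abelian of rank $r$). Computational model: a random access machine with integers written in binary (adding two $n$-bit integers costs $O(n)$, multiplying them costs $O(n\log n\log\log n)$). Each letter of $X_r^{\pm}$ is encoded by a unique bit-string of length $\lceil\log_2 r\rceil+1$, and a word by the concatenation of the codes of its letters. $\tilde O(n^2)$ (quasi-quadratic) means $O(n^2\log^k n)$ for some constant $k\in\mathbb{N}$. *)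

theory Defs
  imports
    "HOL-Algebra.Solvable_Groups"
    "HOL-Library.Log_Nat"
    "HOL-Library.Landau_Symbols"
begin

section \<open>Free groups and free solvable groups\<close>

text \<open>\<open>(i, True)\<close> stands for $x_i$ and \<open>(i, False)\<close> for $x_i^{-1}$, with \<open>1 \<le> i \<le> r\<close>.\<close>

type_synonym letter = "nat \<times> bool"

definition letters :: "nat \<Rightarrow> letter set" where
  "letters r = {1..r} \<times> UNIV"

definition flip :: "letter \<Rightarrow> letter" where
  "flip x = (fst x, \<not> snd x)"

text \<open>A word need not be reduced; the length of a word is the length of the list.\<close>

abbreviation words :: "nat \<Rightarrow> letter list set" where
  "words r \<equiv> lists (letters r)"

fun push :: "letter \<Rightarrow> letter list \<Rightarrow> letter list" where
  "push x [] = [x]"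
| "push x (y # ys) = (if y = flip x then ys else x # y # ys)"

text \<open>The unique freely reduced form, i.e. the element of the free group given by a word.\<close>

definition reduce :: "letter list \<Rightarrow> letter list" where
  "reduce w = foldr push w []"

definition reduced :: "letter list \<Rightarrow> bool" where
  "reduced w \<longleftrightarrow> successively (\<lambda>x y. y \<noteq> flip x) w"

definition free_group :: "nat \<Rightarrow> letter list monoid" where
  "free_group r =
    \<lparr>carrier = {w \<in> words r. reduced w}, mult = (\<lambda>u v. reduce (u @ v)), one = []\<rparr>"

definition derived_term :: "nat \<Rightarrow> nat \<Rightarrow> letter list set" where
  "derived_term r d = (derived (free_group r) ^^ d) (carrier (free_group r))"

definition free_solvable :: "nat \<Rightarrow> nat \<Rightarrow> letter list set monoid" where
  "free_solvable r d = free_group r Mod derived_term r d"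

definition word_value :: "nat \<Rightarrow> nat \<Rightarrow> letter list \<Rightarrow> letter list set" where
  "word_value r d w = derived_term r d #>\<^bsub>free_group r\<^esub> reduce w"

definition word_problem :: "nat \<Rightarrow> nat \<Rightarrow> letter list set" where
  "word_problem r d = {w \<in> words r. word_value r d w = \<one>\<^bsub>free_solvable r d\<^esub>}"

lemma flip_flip [simp]: "flip (flip x) = x"
  by (simp add: flip_def)

lemma flip_neq [simp]: "flip x \<noteq> x" "x \<noteq> flip x"
  by (auto simp: flip_def prod_eq_iff)

lemma flip_in_letters [simp]: "flip x \<in> letters r \<longleftrightarrow> x \<in> letters r"
  by (auto simp: flip_def letters_def mem_Times_iff)

lemma reduced_push: "reduced w \<Longrightarrow> reduced (push x w)"
  by (cases w) (auto simp: reduced_def successively_Cons)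

lemma reduced_foldr_push: "reduced z \<Longrightarrow> reduced (foldr push w z)"
  by (induction w) (auto simp: reduced_push)

lemma reduced_reduce: "reduced (reduce w)"
  unfolding reduce_def by (rule reduced_foldr_push) (simp add: reduced_def)

lemma push_words: "x \<in> letters r \<Longrightarrow> w \<in> words r \<Longrightarrow> push x w \<in> words r"
  by (cases w) auto

lemma reduce_words: "w \<in> words r \<Longrightarrow> reduce w \<in> words r"
  unfolding reduce_def by (induction w) (auto simp: push_words)

lemma reduce_reduced: "reduced w \<Longrightarrow> reduce w = w"
proof (induction w)
  case (Cons x w)
  then have "reduce w = w" by (cases w) (auto simp: reduced_def)
  with Cons.prems show ?case by (cases w) (auto simp: reduce_def reduced_def)
qed (simp add: reduce_def)

lemma push_push_flip: "reduced z \<Longrightarrow> push x (push (flip x) z) = z"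
proof (cases z)
  case (Cons y ys)
  moreover assume "reduced z"
  ultimately show ?thesis
    by (cases ys) (auto simp: reduced_def)
qed simp

lemma foldr_push_reduce:
  assumes "reduced z"
  shows "foldr push (reduce u) z = foldr push u z"
proof (induction u)
  case (Cons x u)
  have r: "reduce (x # u) = push x (reduce u)" by (simp add: reduce_def)
  show ?case
  proof (cases "reduce u")
    case Nil
    then show ?thesis using Cons r by simp
  next
    case (Cons y ys)
    show ?thesis
    proof (cases "y = flip x")
      case True
      have "foldr push u z = push (flip x) (foldr push ys z)"
        using Cons.IH Cons True by simp
      then show ?thesis
        using r Cons True push_push_flip[OF reduced_foldr_push[OF assms]] by simp
    next
      case False
      then show ?thesis using r Cons Cons.IH by simp
    qed
  qed
qed (simp add: reduce_def)

lemma reduce_append: "reduce (u @ v) = foldr push u (reduce v)"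
  by (simp add: reduce_def)

lemma reduce_append_reduce:
  "reduce (reduce u @ v) = reduce (u @ v)" "reduce (u @ reduce v) = reduce (u @ v)"
  by (simp_all add: reduce_append foldr_push_reduce reduced_reduce reduce_reduced)

definition inverse_word :: "letter list \<Rightarrow> letter list" where
  "inverse_word w = rev (map flip w)"

lemma reduce_inverse_word: "reduce (inverse_word w @ w) = []"
proof (induction w)
  case (Cons x w)
  have "push (flip x) (push (flip (flip x)) (reduce w)) = reduce w"
    by (rule push_push_flip[OF reduced_reduce])
  then have "reduce ([flip x, x] @ w) = reduce w" by (simp add: reduce_def)
  then have "reduce (inverse_word w @ [flip x, x] @ w) = reduce (inverse_word w @ w)"
    by (simp only: reduce_append[of "inverse_word w"])
  then show ?case using Cons by (simp add: inverse_word_def)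
qed (simp add: inverse_word_def reduce_def)

theorem group_free_group: "group (free_group r)"
proof (rule groupI)
  fix u v w
  assume *: "u \<in> carrier (free_group r)" "v \<in> carrier (free_group r)" "w \<in> carrier (free_group r)"
  show "u \<otimes>\<^bsub>free_group r\<^esub> v \<in> carrier (free_group r)"
    using * by (simp add: free_group_def reduced_reduce reduce_words)
  show "u \<otimes>\<^bsub>free_group r\<^esub> v \<otimes>\<^bsub>free_group r\<^esub> w = u \<otimes>\<^bsub>free_group r\<^esub> (v \<otimes>\<^bsub>free_group r\<^esub> w)"
    by (simp add: free_group_def reduce_append_reduce)
next
  show "\<one>\<^bsub>free_group r\<^esub> \<in> carrier (free_group r)"
    by (simp add: free_group_def reduced_def)
next
  fix u assume u: "u \<in> carrier (free_group r)"
  then show "\<one>\<^bsub>free_group r\<^esub> \<otimes>\<^bsub>free_group r\<^esub> u = u"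
    by (simp add: free_group_def reduce_reduced)
  have iw: "inverse_word u \<in> words r"
    using u by (auto simp: free_group_def inverse_word_def in_lists_conv_set)
  show "\<exists>v\<in>carrier (free_group r). v \<otimes>\<^bsub>free_group r\<^esub> u = \<one>\<^bsub>free_group r\<^esub>"
    by (rule bexI[of _ "reduce (inverse_word u)"])
      (use reduce_words[OF iw] in \<open>simp_all add: free_group_def reduced_reduce reduce_append_reduce reduce_inverse_word\<close>)
qed

lemma (in group) normal_derived_power: "(derived G ^^ n) (carrier G) \<lhd> G"
proof (induction n)
  case (Suc n)
  show ?case using derived_is_normal[OF Suc] by simp
qed (simp add: normal_inv_iff subgroup_self)

theorem group_free_solvable: "group (free_solvable r d)"
  unfolding free_solvable_def derived_term_def
  by (intro normal.factorgroup_is_group group.normal_derived_power group_free_group)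


section \<open>Random access machines with logarithmic costs\<close>

text \<open>
  Memory cells are indexed by integers (so that address arithmetic is total) and hold
  integers of arbitrary size.
\<close>

datatype location = Cell int | Ind int

datatype operand = Const int | Val location

datatype arith = Add | Sub | Mul

datatype instr =
    Read location
  | Move location operand
  | Arith arith location operand operand
  | Jump nat
  | JumpIfZero operand nat
  | JumpIfPos operand nat
  | Halt bool

type_synonym program = "instr list"

text \<open>The input is a bit string that is read once from left to right.\<close>

record config =
  pc :: nat
  mem :: "int \<Rightarrow> int"
  unread :: "bool list"

definition initial :: "bool list \<Rightarrow> config" where
  "initial bs = \<lparr>pc = 0, mem = (\<lambda>_. 0), unread = bs\<rparr>"

fun address :: "(int \<Rightarrow> int) \<Rightarrow> location \<Rightarrow> int" where
  "address m (Cell i) = i"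
| "address m (Ind i) = m i"

fun operand_value :: "(int \<Rightarrow> int) \<Rightarrow> operand \<Rightarrow> int" where
  "operand_value m (Const c) = c"
| "operand_value m (Val l) = m (address m l)"

fun arith_value :: "arith \<Rightarrow> int \<Rightarrow> int \<Rightarrow> int" where
  "arith_value Add x y = x + y"
| "arith_value Sub x y = x - y"
| "arith_value Mul x y = x * y"

definition store :: "location \<Rightarrow> int \<Rightarrow> config \<Rightarrow> config" where
  "store l v c = c\<lparr>pc := Suc (pc c), mem := (mem c)(address (mem c) l := v)\<rparr>"

text \<open>Reading past the end of the input yields \<open>-1\<close>.\<close>

definition next_symbol :: "bool list \<Rightarrow> int" where
  "next_symbol bs = (case bs of [] \<Rightarrow> -1 | b # _ \<Rightarrow> of_bool b)"

definition jump_if :: "bool \<Rightarrow> nat \<Rightarrow> config \<Rightarrow> config" where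
  "jump_if b l c = c\<lparr>pc := (if b then l else Suc (pc c))\<rparr>"

fun exec :: "instr \<Rightarrow> config \<Rightarrow> config" where
  "exec (Read l) c = (store l (next_symbol (unread c)) c)\<lparr>unread := tl (unread c)\<rparr>"
| "exec (Move l a) c = store l (operand_value (mem c) a) c"
| "exec (Arith f l a b) c =
     store l (arith_value f (operand_value (mem c) a) (operand_value (mem c) b)) c"
| "exec (Jump l) c = jump_if True l c"
| "exec (JumpIfZero a l) c = jump_if (operand_value (mem c) a = 0) l c"
| "exec (JumpIfPos a l) c = jump_if (operand_value (mem c) a > 0) l c"
| "exec (Halt b) c = c"

text \<open>Number of bits of the binary representation, including a sign bit.\<close>

definition bit_size :: "int \<Rightarrow> nat" where
  "bit_size z = floorlog 2 (nat \<bar>z\<bar>) + 1"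

text \<open>
  As \<open>floorlog 2 n\<close> is $\lfloor \log_2 n \rfloor + 1$ for positive \<open>n\<close>, the cost of multiplying two
  \<open>n\<close>-bit integers is of order $n \log n \log\log n$.
\<close>

fun arith_cost :: "arith \<Rightarrow> int \<Rightarrow> int \<Rightarrow> nat" where
  "arith_cost Add x y = max (bit_size x) (bit_size y)"
| "arith_cost Sub x y = max (bit_size x) (bit_size y)"
| "arith_cost Mul x y =
    (let n = max (bit_size x) (bit_size y) in n * floorlog 2 n * floorlog 2 (floorlog 2 n))"

text \<open>Accessing memory is charged for the bits of the addresses and of the contents involved.\<close>

fun address_cost :: "(int \<Rightarrow> int) \<Rightarrow> location \<Rightarrow> nat" where
  "address_cost m (Cell i) = bit_size i"
| "address_cost m (Ind i) = bit_size i + bit_size (m i)"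

fun operand_cost :: "(int \<Rightarrow> int) \<Rightarrow> operand \<Rightarrow> nat" where
  "operand_cost m (Const c) = bit_size c"
| "operand_cost m (Val l) = address_cost m l + bit_size (m (address m l))"

definition store_cost :: "(int \<Rightarrow> int) \<Rightarrow> location \<Rightarrow> int \<Rightarrow> nat" where
  "store_cost m l v = address_cost m l + bit_size v"

fun cost :: "instr \<Rightarrow> config \<Rightarrow> nat" where
  "cost (Read l) c = 1 + store_cost (mem c) l (next_symbol (unread c))"
| "cost (Move l a) c =
     1 + operand_cost (mem c) a + store_cost (mem c) l (operand_value (mem c) a)"
| "cost (Arith f l a b) c =
    (let x = operand_value (mem c) a; y = operand_value (mem c) b in
       1 + operand_cost (mem c) a + operand_cost (mem c) b + arith_cost f x y
         + store_cost (mem c) l (arith_value f x y))"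
| "cost (Jump l) c = 1"
| "cost (JumpIfZero a l) c = 1 + operand_cost (mem c) a"
| "cost (JumpIfPos a l) c = 1 + operand_cost (mem c) a"
| "cost (Halt b) c = 1"

text \<open>
  \<open>computes P c b t\<close>: started in \<open>c\<close>, the program \<open>P\<close> halts with verdict \<open>b\<close> after total cost \<open>t\<close>.
  A run whose program counter leaves \<open>P\<close> has no verdict.
\<close>

inductive computes :: "program \<Rightarrow> config \<Rightarrow> bool \<Rightarrow> nat \<Rightarrow> bool" for P :: program where
  halt: "pc c < length P \<Longrightarrow> P ! pc c = Halt b \<Longrightarrow> computes P c b (cost (Halt b) c)"
| step: "pc c < length P \<Longrightarrow> P ! pc c = i \<Longrightarrow> (\<forall>b. i \<noteq> Halt b) \<Longrightarrow>
    computes P (exec i c) b t \<Longrightarrow> computes P c b (cost i c + t)"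

lemma computes_deterministic:
  "computes P c b t \<Longrightarrow> computes P c b' t' \<Longrightarrow> b' = b \<and> t' = t"
proof (induction arbitrary: b' t' rule: computes.induct)
  case (halt c b)
  from halt(3,1,2) show ?case by (cases rule: computes.cases) simp_all
next
  case (step c i b t)
  note hyps = step.hyps and IH = step.IH
  from step.prems show ?case
  proof (cases rule: computes.cases)
    case halt
    then show ?thesis using hyps(2,3) by metis
  next
    case (step i' s)
    then show ?thesis using hyps(2) IH by metis
  qed
qed


section \<open>Encoded words and running times\<close>

text \<open>An arbitrary assignment of distinct bit strings of the prescribed length to the letters.\<close>

definition letter_code :: "nat \<Rightarrow> (letter \<Rightarrow> bool list) \<Rightarrow> bool" where
  "letter_code r code \<longleftrightarrow>
     inj_on code (letters r) \<and>
     (\<forall>x\<in>letters r. length (code x) = nat \<lceil>log 2 (real r)\<rceil> + 1)"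

lemma letter_code_exists: "\<exists>code. letter_code r code"
proof (cases "r = 0")
  case True
  then show ?thesis by (auto simp: letter_code_def letters_def)
next
  case False
  define k where "k = nat \<lceil>log 2 (real r)\<rceil>"
  define B where "B = {bs :: bool list. set bs \<subseteq> UNIV \<and> length bs = k + 1}"
  have "real r = 2 powr log 2 (real r)" using False by simp
  also have "\<dots> \<le> 2 powr real k" unfolding k_def
    by (intro powr_mono) (auto simp: real_nat_ceiling_ge)
  also have "\<dots> = real (2 ^ k)" by (simp add: powr_realpow)
  finally have "r \<le> 2 ^ k" by (simp only: of_nat_le_iff)
  then have "card (letters r) \<le> card B"
    using card_lists_length_eq[of "UNIV :: bool set" "k + 1"]
    by (simp add: B_def letters_def card_cartesian_product)
  moreover have "finite (letters r)" by (simp add: letters_def)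
  moreover have "finite B"
    unfolding B_def by (rule finite_lists_length_eq) simp
  ultimately have "\<exists>f. inj_on f (letters r) \<and> f ` letters r \<subseteq> B"
    by (simp only: inj_on_iff_card_le)
  then obtain f where f: "inj_on f (letters r)" "f ` letters r \<subseteq> B" by (elim exE conjE)
  have "length (f x) = k + 1" if "x \<in> letters r" for x
    using subsetD[OF f(2) imageI[OF that]] unfolding B_def by (elim CollectE conjE)
  with f(1) show ?thesis unfolding letter_code_def k_def by (intro exI[of _ f] conjI ballI)
qed

definition encode :: "(letter \<Rightarrow> bool list) \<Rightarrow> letter list \<Rightarrow> bool list" where
  "encode code w = concat (map code w)"

text \<open>The bound \<open>T\<close> is a function of the word length.\<close>

definition decides_in_time ::
    "program \<Rightarrow> (letter \<Rightarrow> bool list) \<Rightarrow> letter list set \<Rightarrow> letter list set \<Rightarrow> (nat \<Rightarrow> nat) \<Rightarrow> bool"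
  where
  "decides_in_time P code W L T \<longleftrightarrow>
     (\<forall>w\<in>W. \<exists>t \<le> T (length w). computes P (initial (encode code w)) (w \<in> L) t)"

definition soft_O :: "(nat \<Rightarrow> real) \<Rightarrow> (nat \<Rightarrow> real) set" where
  "soft_O g = (\<Union>k::nat. O(\<lambda>n. g n * log 2 (real n) ^ k))"

end

theory Submission
  imports Defs "HOL-Algebra.Elementary_Groups" "HOL-Algebra.FiniteProduct" "HOL-Real_Asymp.Real_Asymp"
begin

text \<open>
  Let \<open>F\<close> be the free group and let \<open>F\<^sup>k\<close> be the \<open>k\<close>-th term of its derived series. A word traces a path in
  the Cayley graph of \<open>F / F\<^sup>k\<close>, starting at the identity, and its \<open>flow\<close> records for every edge how
  often it is traversed, counted with signs. Two words have the same value modulo \<open>F\<^sup>k\<^sup>+\<^sup>1\<close> if and only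
  if they have the same flow in the Cayley graph of \<open>F / F\<^sup>k\<close> (\<open>same_flow_iff\<close>). In one direction, the
  flow depends only on the element of the free group, and it is additive on \<open>F\<^sup>k\<close>, whose elements are
  closed paths; so it vanishes on commutators of elements of \<open>F\<^sup>k\<close>. In the other direction, a
  transversal of \<open>F\<^sup>k\<close> turns every edge into an element of \<open>F\<^sup>k\<close>, and modulo \<open>F\<^sup>k\<^sup>+\<^sup>1\<close> a word is, up to
  factors that depend only on its end point, the product of the elements of its edges; in this abelian
  group only the flow matters.

  To decide whether two steps of the path of \<open>w\<close> use the same edge it suffices to know which prefixes
  of \<open>w\<close> agree modulo \<open>F\<^sup>k\<close>. This gives a recursion on \<open>k\<close>: number every prefix by the first prefix
  that agrees with it modulo \<open>F\<^sup>k\<close> (\<open>ident\<close>; for \<open>k = 0\<close> all numbers are zero), read off the edges,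
  and obtain the numbers for \<open>k + 1\<close> by comparing flows. The word is trivial in the free solvable group
  of class \<open>d\<close> if and only if after \<open>d\<close> rounds it has the number of the empty prefix
  (\<open>word_problem_iff_ident\<close>).

  For the comparison, the program walks back from each prefix \<open>i\<close> through \<open>i - 1, \<dots>, 0\<close> and keeps one
  counter per edge, which holds the difference of the flows of the prefix \<open>i\<close> and of the current
  prefix, together with the number of nonzero counters. The flows agree when that number is zero, and
  each step of the walk changes a single counter. Hence a round takes \<open>O(n\<^sup>2)\<close> instructions.

  The program is written in a small structured language whose states carry a clock, so that correctness
  and the number of steps are proved together; \<open>compile_correct\<close> transfers both to the machine. The cost
  of an instruction is then bounded without looking at the program any further. All of its arithmetic consists in adding constants, so after \<open>s\<close> instructions the memory contains only numbers of
  size \<open>O(s)\<close>, and every instruction costs \<open>O(log s)\<close> (\<open>computes_of_steps\<close>).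
\<close>


section \<open>Flows along paths in Cayley graphs\<close>

text \<open>
  Vertices are given by a labelling \<open>L\<close> of words: a path that has spelled \<open>u\<close> is at the vertex \<open>L u\<close>.
  Labels are cosets in the group theory and numbers of prefixes in the algorithm. All edges point in the
  direction of a generator, so an inverse letter uses the edge that starts at its end point.
\<close>

definition edge_of :: "(letter list \<Rightarrow> 'v) \<Rightarrow> letter list \<Rightarrow> letter \<Rightarrow> 'v \<times> nat" where
  "edge_of L u x = (if snd x then L u else L (u @ [x]), fst x)"

definition sign :: "letter \<Rightarrow> int" where
  "sign x = (if snd x then 1 else -1)"

fun flow :: "(letter list \<Rightarrow> 'v) \<Rightarrow> letter list \<Rightarrow> letter list \<Rightarrow> 'v \<times> nat \<Rightarrow> int" where
  "flow L u [] e = 0"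
| "flow L u (x # w) e = (if edge_of L u x = e then sign x else 0) + flow L (u @ [x]) w e"

lemma flow_append: "flow L u (v @ w) e = flow L u v e + flow L (u @ v) w e"
  by (induction v arbitrary: u) auto

lemma flow_take:
  "i \<le> length w \<Longrightarrow>
   flow L [] (take i w) e = (\<Sum>t<i. if edge_of L (take t w) (w ! t) = e then sign (w ! t) else 0)"
  by (induction i) (auto simp: take_Suc_conv_app_nth flow_append)

fun path_edges :: "(letter list \<Rightarrow> 'v) \<Rightarrow> letter list \<Rightarrow> letter list \<Rightarrow> ('v \<times> nat) set" where
  "path_edges L u [] = {}"
| "path_edges L u (x # w) = insert (edge_of L u x) (path_edges L (u @ [x]) w)"

lemma finite_path_edges [simp]: "finite (path_edges L u w)"
  by (induction w arbitrary: u) auto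

text \<open>
  The \<open>f\<close>-weights of the edges along a path, each with the sign of its direction, multiplied in \<open>A\<close>. For
  abelian \<open>A\<close> this extends \<open>f\<close> to a homomorphism from flows to \<open>A\<close>.
\<close>

fun path_sum ::
    "('a, 'b) monoid_scheme \<Rightarrow> ('v \<times> nat \<Rightarrow> 'a) \<Rightarrow> (letter list \<Rightarrow> 'v) \<Rightarrow> letter list \<Rightarrow> letter list \<Rightarrow> 'a"
  where
  "path_sum A f L u [] = \<one>\<^bsub>A\<^esub>"
| "path_sum A f L u (x # w) = f (edge_of L u x) [^]\<^bsub>A\<^esub> sign x \<otimes>\<^bsub>A\<^esub> path_sum A f L (u @ [x]) w"

text \<open>
  In an abelian group the factors along a path can be collected edge by edge.
\<close>

lemma (in comm_group) path_sum_eq_finprod: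
  assumes "finite E" "f ` E \<subseteq> carrier G" "path_edges L u w \<subseteq> E"
  shows "path_sum G f L u w = finprod G (\<lambda>e. f e [^] flow L u w e) E"
  using assms(3)
proof (induction w arbitrary: u)
  case Nil
  then show ?case by simp
next
  case (Cons x w)
  let ?e = "edge_of L u x"
  have f: "e \<in> E \<Longrightarrow> f e \<in> carrier G" for e using assms(2) by auto
  have "finprod G (\<lambda>e. f e [^] flow L u (x # w) e) E
      = finprod G (\<lambda>e. (if ?e = e then f e [^] sign x else \<one>) \<otimes> f e [^] flow L (u @ [x]) w e) E"
    by (rule finprod_cong') (use f in \<open>auto simp: int_pow_mult\<close>)
  also have "\<dots> = finprod G (\<lambda>e. if ?e = e then f e [^] sign x else \<one>) E \<otimes> finprod G (\<lambda>e. f e [^] flow L (u @ [x]) w e) E"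
    by (rule finprod_multf) (use f in auto)
  also have "finprod G (\<lambda>e. if ?e = e then f e [^] sign x else \<one>) E = f ?e [^] sign x"
    by (rule finprod_singleton) (use f Cons.prems assms(1) in auto)
  finally show ?case using Cons by simp
qed

text \<open>
  A sum along a path depends only on its flow. This is used twice: with integers, to find the end of a path from its flow, and with
  the abelianisation of a normal subgroup, to find the value of a word.
\<close>

lemma (in comm_group) path_sum_flow_cong:
  assumes "flow L u v = flow L u' v'"
    and "f ` path_edges L u v \<subseteq> carrier G" "f ` path_edges L u' v' \<subseteq> carrier G"
  shows "path_sum G f L u v = path_sum G f L u' v'"
  using assms
    path_sum_eq_finprod[of "path_edges L u v \<union> path_edges L u' v'" f L u v]
    path_sum_eq_finprod[of "path_edges L u v \<union> path_edges L u' v'" f L u' v']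
  by (simp add: image_Un)

lemma flow_same_start:
  assumes L: "\<And>u v. reduce u = reduce v \<Longrightarrow> L u = L v" and u: "reduce u = reduce u'"
  shows "flow L u w = flow L u' w"
proof -
  have *: "reduce (u @ v) = reduce (u' @ v)" if "reduce u = reduce u'" for u u' v
    by (metis reduce_append_reduce(1) that)
  have "flow L u w e = flow L u' w e" for e
    using u
  proof (induction w arbitrary: u u')
    case (Cons x w)
    have "edge_of L u x = edge_of L u' x"
      using L[OF Cons.prems] L[OF *[OF Cons.prems]] by (simp add: edge_of_def)
    then show ?case using Cons.IH[OF *[OF Cons.prems]] by simp
  qed simp
  then show ?thesis by blast
qed

lemma reduce_cancel: "reduce (u @ [x, flip x]) = reduce u"
proof -
  have "push x (push (flip x) []) = []" by simp
  then have "reduce [x, flip x] = []" by (simp add: reduce_def)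
  then show ?thesis by (metis append.right_neutral reduce_append_reduce(2))
qed

text \<open>
  A letter followed by its inverse traverses one edge in both directions, so free reduction does
  not change the flow: the flow is defined on the elements of the free group.
\<close>

lemma flow_reduce:
  assumes L: "\<And>u v. reduce u = reduce v \<Longrightarrow> L u = L v"
  shows "flow L u (reduce w) = flow L u w"
proof -
  have push: "flow L u (push x w) e = flow L u (x # w) e" for u x w e
  proof (cases "\<exists>ys. w = flip x # ys")
    case True
    then obtain ys where ys: "w = flip x # ys" by blast
    have "L (u @ [x, flip x]) = L u" by (rule L[OF reduce_cancel])
    moreover have "flow L (u @ [x, flip x]) ys = flow L u ys"
      by (rule flow_same_start[OF _ reduce_cancel]) (rule L)
    ultimately show ?thesis
      using ys by (auto simp: edge_of_def sign_def flip_def)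
  next
    case False
    then show ?thesis by (cases w) auto
  qed
  have "flow L u (reduce w) e = flow L u w e" for e
  proof (induction w arbitrary: u)
    case (Cons x w)
    have "reduce (x # w) = push x (reduce w)" by (simp add: reduce_def)
    then show ?case using Cons by (simp add: push)
  qed (simp add: reduce_def)
  then show ?thesis by blast
qed

lemma reduce_carrier: "u \<in> words r \<Longrightarrow> reduce u \<in> carrier (free_group r)"
  by (simp add: free_group_def reduced_reduce reduce_words)

lemma mult_reduce: "reduce u \<otimes>\<^bsub>free_group r\<^esub> reduce v = reduce (u @ v)"
  by (simp add: free_group_def reduce_append_reduce)

lemma reduce_Nil: "reduce [] = \<one>\<^bsub>free_group r\<^esub>"
  by (simp add: free_group_def reduce_def)

lemma carrier_word: "u \<in> carrier (free_group r) \<Longrightarrow> u \<in> words r \<and> reduce u = u"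
  by (simp add: free_group_def reduce_reduced)

lemma (in group) inv_cancel_left:
  "x \<in> carrier G \<Longrightarrow> y \<in> carrier G \<Longrightarrow> inv x \<otimes> (x \<otimes> y) = y"
  "x \<in> carrier G \<Longrightarrow> y \<in> carrier G \<Longrightarrow> x \<otimes> (inv x \<otimes> y) = y"
  by (simp_all flip: m_assoc)

locale free_normal =
  fixes r :: nat and N :: "letter list set"
  assumes normal: "N \<lhd> free_group r"
begin

sublocale normal N "free_group r" by (rule normal)

abbreviation F where "F \<equiv> free_group r"
abbreviation M where "M \<equiv> derived F N"

definition coset :: "letter list \<Rightarrow> letter list set" where
  "coset u = N #>\<^bsub>F\<^esub> reduce u"

lemma N_carrier: "N \<subseteq> carrier F" by (rule subset)

lemma coset_append:
  "u \<in> words r \<Longrightarrow> v \<in> words r \<Longrightarrow> coset (u @ v) = coset u #>\<^bsub>F\<^esub> reduce v"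
  unfolding coset_def mult_reduce[of r u v, symmetric]
  by (simp add: coset_mult_assoc N_carrier reduce_carrier)

lemma coset_reduce: "reduce u = reduce v \<Longrightarrow> coset u = coset v"
  by (simp add: coset_def)

lemma coset_N:
  assumes "reduce u \<in> N"
  shows "coset u = coset []"
proof -
  have "\<one>\<^bsub>F\<^esub> = reduce []" by (simp add: free_group_def reduce_def)
  then have "reduce [] \<in> N" using subgroup.one_closed[OF subgroup_axioms] by simp
  with assms show ?thesis by (simp add: coset_def rcos_const[OF is_group])
qed

lemma flow_same_coset:
  "u \<in> words r \<Longrightarrow> u' \<in> words r \<Longrightarrow> coset u = coset u' \<Longrightarrow> w \<in> words r \<Longrightarrow>
   flow coset u w = flow coset u' w"
proof (induction w arbitrary: u u')
  case (Cons x w)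
  have "coset (u @ [x]) = coset (u' @ [x])"
    using Cons.prems by (simp add: coset_append)
  with Cons.prems Cons.IH[of "u @ [x]" "u' @ [x]"] show ?case
    by (auto simp: edge_of_def fun_eq_iff)
qed (simp add: fun_eq_iff)

text \<open>
  The path of an element of \<open>N\<close> is closed, so a word after it starts again at the identity vertex.
\<close>

lemma flow_mult:
  assumes "u \<in> N" "v \<in> carrier F"
  shows "flow coset [] (u \<otimes>\<^bsub>F\<^esub> v) e = flow coset [] u e + flow coset [] v e"
proof -
  have u: "u \<in> words r" "reduce u = u" and v: "v \<in> words r"
    using assms N_carrier carrier_word by blast+
  have "flow coset [] (u \<otimes>\<^bsub>F\<^esub> v) e = flow coset [] (u @ v) e"
    by (simp add: free_group_def flow_reduce[OF coset_reduce])
  also have "\<dots> = flow coset [] u e + flow coset u v e"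
    by (simp add: flow_append)
  also have "flow coset u v = flow coset [] v"
    using u v assms by (intro flow_same_coset coset_N) auto
  finally show ?thesis .
qed

lemma flow_one: "flow coset [] \<one>\<^bsub>F\<^esub> e = 0"
  by (simp add: free_group_def)

lemma flow_inv:
  assumes "u \<in> N"
  shows "flow coset [] (inv\<^bsub>F\<^esub> u) e = - flow coset [] u e"
proof -
  have "inv\<^bsub>F\<^esub> u \<in> carrier F" using assms N_carrier by auto
  from flow_mult[OF assms this, of e] show ?thesis
    using assms N_carrier flow_one r_inv by (simp add: subset_iff)
qed

text \<open>
  By \<open>flow_mult\<close> the flow is a homomorphism from \<open>N\<close> to an abelian group, so it vanishes on
  commutators.
\<close>

lemma flow_derived:
  assumes "m \<in> M"
  shows "m \<in> N" "flow coset [] m e = 0"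
proof -
  let ?K = "{u \<in> N. flow coset [] u = (\<lambda>e. 0)}"
  have NF: "u \<in> carrier F" if "u \<in> N" for u using that N_carrier by blast
  have "subgroup ?K F"
  proof (rule subgroupI)
    have "\<one>\<^bsub>F\<^esub> \<in> ?K" using flow_one subgroup.one_closed[OF subgroup_axioms] by (simp add: fun_eq_iff)
    then show "?K \<noteq> {}" by blast
  qed (use NF in \<open>auto simp: fun_eq_iff flow_inv flow_mult\<close>)
  moreover have "derived_set F N \<subseteq> ?K"
    by (auto simp: fun_eq_iff flow_inv flow_mult NF)
  ultimately have "M \<subseteq> ?K"
    unfolding derived_def by (intro generate_subgroup_incl)
  with assms show "m \<in> N" "flow coset [] m e = 0" by auto
qed

definition head :: "letter list set \<times> nat \<Rightarrow> letter list set" where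
  "head e = fst e #>\<^bsub>F\<^esub> [(snd e, True)]"

lemma letter_carrier: "x \<in> letters r \<Longrightarrow> [x] \<in> carrier F \<and> reduce [x] = [x]"
  by (simp add: free_group_def reduced_def reduce_def)

lemma edge_ends:
  assumes "u \<in> words r" "x \<in> letters r"
  shows "fst (edge_of coset u x) = (if snd x then coset u else coset (u @ [x]))"
    and "head (edge_of coset u x) = (if snd x then coset (u @ [x]) else coset u)"
proof -
  show "fst (edge_of coset u x) = (if snd x then coset u else coset (u @ [x]))"
    by (simp add: edge_of_def)
  have "coset (u @ [x]) #>\<^bsub>F\<^esub> [flip x] = coset u"
    using assms coset_append[of "u @ [x]" "[flip x]"] coset_reduce[OF reduce_cancel[of u x]]
    by (simp add: letter_carrier)
  then show "head (edge_of coset u x) = (if snd x then coset (u @ [x]) else coset u)"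
    using assms coset_append[of u "[x]"]
    by (cases x) (auto simp: head_def edge_of_def flip_def letter_carrier)
qed

text \<open>
  The end of a path can be read off from the boundary of its flow. Concretely, give each edge the weight
  +1 if it enters a fixed vertex and -1 if it leaves it (0 if it does both): the sum along a path
  telescopes to the difference between its end and its start, and all paths here start at the identity.
\<close>

lemma flow_determines_end:
  assumes "u \<in> words r" "v \<in> words r" "flow coset [] u = flow coset [] v"
  shows "coset u = coset v"
proof (rule ccontr)
  assume neq: "coset u \<noteq> coset v"
  define ind :: "letter list set \<Rightarrow> int" where "ind C = of_bool (C = coset u)" for C
  define f where "f e = ind (head e) - ind (fst e)" for e
  interpret Z: comm_group integer_group
    by (simp add: abelian_integer_group)
  have "path_sum integer_group f coset a w = ind (coset (a @ w)) - ind (coset a)"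
    if "a \<in> words r" "w \<in> words r" for a w
    using that
  proof (induction w arbitrary: a)
    case (Cons x w)
    have "f (edge_of coset a x) [^]\<^bsub>integer_group\<^esub> sign x = ind (coset (a @ [x])) - ind (coset a)"
      using Cons.prems by (simp add: f_def edge_ends sign_def group_int_pow_integer_group)
    then show ?case using Cons by simp
  qed simp
  moreover have "path_sum integer_group f coset [] u = path_sum integer_group f coset [] v"
    by (rule Z.path_sum_flow_cong[OF assms(3)]) auto
  ultimately have "ind (coset u) = ind (coset v)" using assms by simp
  then show False using neq by (simp add: ind_def)
qed

lemma M_normal: "M \<lhd> F"
  by (rule derived_is_normal[OF normal])

text \<open>
  Choose a representative \<open>t C\<close> of every coset \<open>C\<close>. An edge from \<open>C\<close> to \<open>C'\<close> with generator \<open>x\<close> gives the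
  element \<open>y = t C \<cdot> x \<cdot> (t C')\<^sup>-\<^sup>1\<close> of \<open>N\<close>. Along a path the representatives of the inner vertices
  cancel, so \<open>z a w\<close>, the word \<open>w\<close> corrected by the representatives of its two ends, is a product of such
  elements and their inverses. In the abelian group \<open>N / M\<close> this product depends only on the flow.
\<close>

theorem same_flow_imp_same_class:
  assumes u: "u \<in> words r" and v: "v \<in> words r"
    and flow: "flow coset [] u = flow coset [] v"
  shows "M #>\<^bsub>F\<^esub> reduce u = M #>\<^bsub>F\<^esub> reduce v"
proof -
  define t where "t C = (SOME a. a \<in> carrier F \<and> C = N #>\<^bsub>F\<^esub> a)" for C
  have t: "t (coset a) \<in> carrier F" "coset a = N #>\<^bsub>F\<^esub> t (coset a)" if "a \<in> words r" for a
  proof -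
    have "\<exists>b. b \<in> carrier F \<and> coset a = N #>\<^bsub>F\<^esub> b"
      using that reduce_carrier coset_def by blast
    then have "t (coset a) \<in> carrier F \<and> coset a = N #>\<^bsub>F\<^esub> t (coset a)"
      unfolding t_def by (rule someI_ex)
    then show "t (coset a) \<in> carrier F" "coset a = N #>\<^bsub>F\<^esub> t (coset a)" by blast+
  qed
  define z where "z a w = t (coset a) \<otimes>\<^bsub>F\<^esub> reduce w \<otimes>\<^bsub>F\<^esub> inv\<^bsub>F\<^esub> t (coset (a @ w))" for a w
  have z_N: "z a w \<in> N" if "a \<in> words r" "w \<in> words r" for a w
  proof -
    have aw: "a @ w \<in> words r" using that by simp
    have "N #>\<^bsub>F\<^esub> (t (coset a) \<otimes>\<^bsub>F\<^esub> reduce w) = N #>\<^bsub>F\<^esub> t (coset (a @ w))"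
      using t[OF that(1)] t[OF aw] coset_append[OF that] coset_mult_assoc[OF N_carrier, of "t (coset a)" "reduce w"]
        reduce_carrier[OF that(2)] by simp
    then have "t (coset a) \<otimes>\<^bsub>F\<^esub> reduce w \<in> N #>\<^bsub>F\<^esub> t (coset (a @ w))"
      using rcos_self[of "t (coset a) \<otimes>\<^bsub>F\<^esub> reduce w" N] t[OF that(1)] reduce_carrier[OF that(2)] is_subgroup
      by auto
    then show ?thesis
      unfolding z_def using rcos_module_imp[of "t (coset (a @ w))" "t (coset a) \<otimes>\<^bsub>F\<^esub> reduce w"]
        t[OF aw] t[OF that(1)] reduce_carrier[OF that(2)] is_group by simp
  qed
  \<comment> \<open>the representatives at the inner vertex cancel\<close>
  have z_append: "z a (w @ w') = z a w \<otimes>\<^bsub>F\<^esub> z (a @ w) w'"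
    if "a \<in> words r" "w \<in> words r" "w' \<in> words r" for a w w'
    using that unfolding z_def mult_reduce[of r w w', symmetric]
    by (simp add: t(1) reduce_carrier m_assoc inv_cancel_left)

  let ?H = "F\<lparr>carrier := N\<rparr>"
  define A where "A = ?H Mod M"
  define cls where "cls h = M #>\<^bsub>?H\<^esub> h" for h
  interpret A: comm_group A
    unfolding A_def by (rule derived_quot_of_subgroup_is_comm_group[OF is_subgroup])
  have MH: "M \<lhd> ?H" by (rule derived_subgroup_is_normal[OF is_subgroup])
  interpret cls: group_hom ?H A cls
    unfolding group_hom_def group_hom_axioms_def
    using normal.r_coset_hom_Mod[OF MH] subgroup_imp_group[OF is_subgroup] A.group_axioms
    by (auto simp: A_def cls_def[abs_def])
  define y where "y e = t (fst e) \<otimes>\<^bsub>F\<^esub> [(snd e, True)] \<otimes>\<^bsub>F\<^esub> inv\<^bsub>F\<^esub> t (head e)" for e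
  have y_step: "cls (y (edge_of coset a x)) [^]\<^bsub>A\<^esub> sign x = cls (z a [x])
      \<and> cls (y (edge_of coset a x)) \<in> carrier A"
    if ax: "a \<in> words r" "x \<in> letters r" for a x
  proof (cases "snd x")
    case True
    then have "y (edge_of coset a x) = z a [x]"
      using ax edge_ends[OF ax]
      by (cases x) (simp add: y_def z_def edge_of_def letter_carrier)
    then show ?thesis using True ax z_N[of a "[x]"] cls.hom_closed by (simp add: sign_def)
  next
    case False
    let ?b = "a @ [x]"
    have b: "?b \<in> words r" using ax by simp
    have x: "[x] \<otimes>\<^bsub>F\<^esub> [flip x] = \<one>\<^bsub>F\<^esub>"
      using reduce_cancel[of "[]" x] by (simp add: free_group_def) (simp add: reduce_def)
    have x': "[flip x] = inv\<^bsub>F\<^esub> [x]"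
      using ax inv_equality[of "[flip x]" "[x]"] x letter_carrier
      by (metis flip_in_letters inv_equality inv_inv)
    have y: "y (edge_of coset a x) = inv\<^bsub>F\<^esub> z a [x]"
      using ax edge_ends[OF ax] False t(1)[OF ax(1)] t(1)[OF b] x'
      by (cases x) (simp add: y_def z_def edge_of_def flip_def letter_carrier inv_mult_group m_assoc)
    have zN: "z a [x] \<in> N" using ax z_N by simp
    then have "cls (inv\<^bsub>F\<^esub> z a [x]) = inv\<^bsub>A\<^esub> cls (z a [x])"
      using cls.hom_inv[of "z a [x]"] m_inv_consistent[OF is_subgroup zN] by simp
    then show ?thesis using False y zN cls.hom_closed[of "z a [x]"]
      by (simp add: sign_def A.int_pow_neg)
  qed
  have z_sum: "cls (z a w) = path_sum A (cls \<circ> y) coset a w \<and>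
      (cls \<circ> y) ` path_edges coset a w \<subseteq> carrier A"
    if "a \<in> words r" "w \<in> words r" for a w
    using that
  proof (induction w arbitrary: a)
    case Nil
    then have "z a [] = \<one>\<^bsub>F\<^esub>" using t(1)[OF Nil(1)] reduce_Nil[of r] by (simp add: z_def)
    then show ?case using cls.hom_one by simp
  next
    case (Cons x w)
    have "z a (x # w) = z a [x] \<otimes>\<^bsub>F\<^esub> z (a @ [x]) w"
      using z_append[of a "[x]" w] Cons.prems by simp
    then have "cls (z a (x # w)) = cls (z a [x]) \<otimes>\<^bsub>A\<^esub> cls (z (a @ [x]) w)"
      using cls.hom_mult[of "z a [x]" "z (a @ [x]) w"] z_N Cons.prems by simp
    then show ?case using Cons y_step[of a x] by simp
  qed
  have "cls (z [] u) = cls (z [] v)"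
    using z_sum[of "[]" u] z_sum[of "[]" v] u v A.path_sum_flow_cong[OF flow, of "cls \<circ> y"] by simp
  then have M_eq: "M #>\<^bsub>F\<^esub> z [] u = M #>\<^bsub>F\<^esub> z [] v"
    by (simp add: cls_def r_coset_def)
  \<comment> \<open>the two words have the same end points, so the corrections are the same for both\<close>
  interpret M: normal M F by (rule M_normal)
  let ?a = "t (coset [])" and ?c = "t (coset u)"
  have a: "?a \<in> carrier F" and c: "?c \<in> carrier F" using t(1) u by auto
  have ru: "reduce u \<in> carrier F" and rv: "reduce v \<in> carrier F"
    using u v reduce_carrier by auto
  have zu: "z [] u = ?a \<otimes>\<^bsub>F\<^esub> reduce u \<otimes>\<^bsub>F\<^esub> inv\<^bsub>F\<^esub> ?c" and zv: "z [] v = ?a \<otimes>\<^bsub>F\<^esub> reduce v \<otimes>\<^bsub>F\<^esub> inv\<^bsub>F\<^esub> ?c"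
    using flow_determines_end[OF u v flow] by (auto simp: z_def)
  have "z [] u \<in> M #>\<^bsub>F\<^esub> z [] v"
    using M_eq rcos_self[of "z [] u" M] a c ru zu M.is_subgroup by auto
  then have "z [] u \<otimes>\<^bsub>F\<^esub> inv\<^bsub>F\<^esub> z [] v \<in> M"
    using M.rcos_module_imp[of "z [] v" "z [] u"] zu zv a c ru rv is_group by simp
  also have "z [] u \<otimes>\<^bsub>F\<^esub> inv\<^bsub>F\<^esub> z [] v = ?a \<otimes>\<^bsub>F\<^esub> (reduce u \<otimes>\<^bsub>F\<^esub> inv\<^bsub>F\<^esub> reduce v) \<otimes>\<^bsub>F\<^esub> inv\<^bsub>F\<^esub> ?a"
    using a c ru rv unfolding zu zv by (simp add: inv_mult_group m_assoc inv_cancel_left)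
  finally have "inv\<^bsub>F\<^esub> ?a \<otimes>\<^bsub>F\<^esub> (?a \<otimes>\<^bsub>F\<^esub> (reduce u \<otimes>\<^bsub>F\<^esub> inv\<^bsub>F\<^esub> reduce v) \<otimes>\<^bsub>F\<^esub> inv\<^bsub>F\<^esub> ?a) \<otimes>\<^bsub>F\<^esub> ?a \<in> M"
    using M.inv_op_closed1 a by simp
  then have "reduce u \<otimes>\<^bsub>F\<^esub> inv\<^bsub>F\<^esub> reduce v \<in> M"
    using a ru rv by (simp add: m_assoc inv_cancel_left)
  then have "reduce u \<in> M #>\<^bsub>F\<^esub> reduce v"
    using M.rcos_module_rev[of "reduce v" "reduce u"] ru rv is_group by simp
  then show ?thesis
    using repr_independence[OF _ rv M.is_subgroup] by simp
qed

theorem same_flow_iff: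
  assumes u: "u \<in> words r" and v: "v \<in> words r"
  shows "flow coset [] u = flow coset [] v \<longleftrightarrow> M #>\<^bsub>F\<^esub> reduce u = M #>\<^bsub>F\<^esub> reduce v"
proof
  assume eq: "M #>\<^bsub>F\<^esub> reduce u = M #>\<^bsub>F\<^esub> reduce v"
  interpret M: normal M F by (rule M_normal)
  have "reduce u \<in> M #>\<^bsub>F\<^esub> reduce v"
    using eq rcos_self[of "reduce u" M] reduce_carrier[OF u] M.is_subgroup by auto
  then obtain m where m: "m \<in> M" "reduce u = m \<otimes>\<^bsub>F\<^esub> reduce v"
    unfolding r_coset_def by blast
  have "flow coset [] (reduce u) e = flow coset [] (reduce v) e" for e
    using flow_mult[of m "reduce v" e] flow_derived[OF m(1)] m(2) reduce_carrier[OF v] by simp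
  then show "flow coset [] u = flow coset [] v"
    by (simp add: flow_reduce[OF coset_reduce] fun_eq_iff)
qed (rule same_flow_imp_same_class[OF u v])

end

text \<open>
  Whether two steps along \<open>w\<close> use the same edge depends only on which prefixes of \<open>w\<close> carry the same
  label. Therefore cosets may be replaced by any names for them.
\<close>

lemma same_flow_relabel:
  assumes L: "\<And>i j. i \<le> length w \<Longrightarrow> j \<le> length w \<Longrightarrow>
      L (take i w) = L (take j w) \<longleftrightarrow> L' (take i w) = L' (take j w)"
    and ij: "i \<le> length w" "j \<le> length w"
    and eq: "flow L [] (take i w) = flow L [] (take j w)"
  shows "flow L' [] (take i w) = flow L' [] (take j w)"
proof
  fix e
  let ?e = "\<lambda>L t. edge_of L (take t w) (w ! t)"
  have same: "?e L s = ?e L t \<longleftrightarrow> ?e L' s = ?e L' t" if "s < length w" "t < length w" for s t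
    using that L[of s t] L[of "Suc s" t] L[of s "Suc t"] L[of "Suc s" "Suc t"]
    by (auto simp: edge_of_def take_Suc_conv_app_nth)
  show "flow L' [] (take i w) e = flow L' [] (take j w) e"
  proof (cases "\<exists>t<length w. ?e L' t = e")
    case True
    then obtain t where t: "t < length w" "?e L' t = e" by blast
    have "flow L' [] (take k w) e = flow L [] (take k w) (?e L t)" if "k \<le> length w" for k
      using that same[OF _ t(1)] t(2) by (auto simp: flow_take intro!: sum.cong)
    then show ?thesis using eq ij by simp
  next
    case False
    then have "flow L' [] (take k w) e = 0" if "k \<le> length w" for k
      using that by (auto simp: flow_take intro!: sum.neutral)
    then show ?thesis using ij by simp
  qed
qed


section \<open>Numbering the prefixes of a word\<close>

text \<open>
  The first prefix of \<open>w\<close> that agrees with the prefix of length \<open>i\<close> in the free solvable group of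
  class \<open>k\<close>. The edges on level \<open>k\<close> are named by these numbers, which makes the recursion computable.
\<close>

fun ident :: "letter list \<Rightarrow> nat \<Rightarrow> nat \<Rightarrow> nat" where
  "ident w 0 i = 0"
| "ident w (Suc k) i =
     (LEAST j. flow (\<lambda>u. ident w k (length u)) [] (take j w)
             = flow (\<lambda>u. ident w k (length u)) [] (take i w))"

definition prefix_flow :: "letter list \<Rightarrow> nat \<Rightarrow> nat \<Rightarrow> nat \<times> nat \<Rightarrow> int" where
  "prefix_flow w k i = flow (\<lambda>u. ident w k (length u)) [] (take i w)"

lemma ident_Suc: "ident w (Suc k) i = (LEAST j. prefix_flow w k j = prefix_flow w k i)"
  by (simp add: prefix_flow_def)

declare ident.simps(2) [simp del]

lemma ident_le: "ident w k i \<le> i"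
  by (cases k) (auto simp: ident_Suc intro: Least_le)

lemma ident_Suc_eq_iff:
  "ident w (Suc k) i = ident w (Suc k) j \<longleftrightarrow> prefix_flow w k i = prefix_flow w k j"
proof
  assume eq: "ident w (Suc k) i = ident w (Suc k) j"
  have "prefix_flow w k (ident w (Suc k) i) = prefix_flow w k i" for i
    unfolding ident_Suc by (rule LeastI) (rule refl)
  from this[of i] this[of j] eq show "prefix_flow w k i = prefix_flow w k j" by simp
qed (simp add: ident_Suc)

lemma derived_term_normal: "derived_term r k \<lhd> free_group r"
  unfolding derived_term_def by (rule group.normal_derived_power[OF group_free_group])

theorem ident_eq_iff:
  assumes w: "w \<in> words r" and "i \<le> length w" "j \<le> length w"
  shows "ident w k i = ident w k j \<longleftrightarrow>
    derived_term r k #>\<^bsub>free_group r\<^esub> reduce (take i w)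
      = derived_term r k #>\<^bsub>free_group r\<^esub> reduce (take j w)"
  using assms(2,3)
proof (induction k arbitrary: i j)
  have take: "take i w \<in> words r" for i
    using w by (meson in_listsI in_listsD in_set_takeD)
  {
    case 0
    interpret group "free_group r" by (rule group_free_group)
    have "derived_term r 0 #>\<^bsub>free_group r\<^esub> reduce (take i w) = derived_term r 0" for i
      using coset_join2[OF reduce_carrier[OF take] subgroup_self reduce_carrier[OF take]]
      by (simp add: derived_term_def)
    then show ?case by simp
  next
    case (Suc k)
    interpret free_normal r "derived_term r k"
      by (rule free_normal.intro) (rule derived_term_normal)
    let ?L = "\<lambda>u. ident w k (length u)"
    have IH: "?L (take i w) = ?L (take j w) \<longleftrightarrow> coset (take i w) = coset (take j w)"
      if "i \<le> length w" "j \<le> length w" for i j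
      using Suc.IH[OF that] that by (simp add: coset_def)
    have "prefix_flow w k i = prefix_flow w k j
        \<longleftrightarrow> flow coset [] (take i w) = flow coset [] (take j w)"
      unfolding prefix_flow_def
      using same_flow_relabel[of w ?L coset i j] same_flow_relabel[of w coset ?L i j] IH Suc.prems
      by blast
    also have "\<dots> \<longleftrightarrow> M #>\<^bsub>F\<^esub> reduce (take i w) = M #>\<^bsub>F\<^esub> reduce (take j w)"
      by (rule same_flow_iff[OF take take])
    also have "M = derived_term r (Suc k)" by (simp add: derived_term_def)
    finally show ?case by (simp only: ident_Suc_eq_iff)
  }
qed

corollary word_problem_iff_ident:
  assumes w: "w \<in> words r"
  shows "w \<in> word_problem r d \<longleftrightarrow> ident w d (length w) = 0"
proof -
  interpret N: normal "derived_term r d" "free_group r" by (rule derived_term_normal)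
  have "derived_term r d #>\<^bsub>free_group r\<^esub> reduce [] = derived_term r d"
    using N.coset_mult_one[OF N.subset] by (simp add: reduce_Nil[of r])
  moreover have "\<one>\<^bsub>free_solvable r d\<^esub> = derived_term r d"
    by (simp add: free_solvable_def FactGroup_def)
  moreover have "ident w d 0 = 0" using ident_le[of w d 0] by simp
  ultimately show ?thesis
    using ident_eq_iff[OF w, of "length w" 0 d] w by (simp add: word_problem_def word_value_def)
qed

definition step_edge :: "letter list \<Rightarrow> nat \<Rightarrow> nat \<Rightarrow> nat \<times> nat" where
  "step_edge w k t = (ident w k (if snd (w ! t) then t else Suc t), fst (w ! t))"

lemma prefix_flow_0 [simp]: "prefix_flow w k 0 e = 0"
  by (simp add: prefix_flow_def)

text \<open>
  One step changes the flow at one edge only; this is what makes the incremental comparison cheap.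
\<close>

lemma prefix_flow_Suc:
  assumes "t < length w"
  shows "prefix_flow w k (Suc t) e
    = prefix_flow w k t e + (if step_edge w k t = e then sign (w ! t) else 0)"
  using assms
  by (auto simp: prefix_flow_def take_Suc_conv_app_nth flow_append step_edge_def edge_of_def)

lemma prefix_flow_support:
  "i \<le> length w \<Longrightarrow> prefix_flow w k i e \<noteq> 0 \<Longrightarrow> \<exists>t<i. step_edge w k t = e"
  by (induction i) (auto simp: prefix_flow_Suc less_Suc_eq split: if_splits)

text \<open>
  How the number of nonzero counters is kept up to date.
\<close>

lemma card_support_upd:
  fixes f :: "'a \<Rightarrow> int"
  assumes "finite {e. f e \<noteq> 0}"
  shows "int (card {x. (f(e := c)) x \<noteq> 0})
    = int (card {x. f x \<noteq> 0}) + of_bool (f e = 0) - of_bool (c = 0)"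
proof -
  have 1: "{x. (f(e := c)) x \<noteq> 0} = {x. f x \<noteq> 0} - {e} \<union> (if c = 0 then {} else {e})" by auto
  have 2: "card {x. f x \<noteq> 0} = card ({x. f x \<noteq> 0} - {e}) + of_bool (f e \<noteq> 0)"
  proof (cases "f e = 0")
    case True
    then have "{x. f x \<noteq> 0} - {e} = {x. f x \<noteq> 0}" by blast
    with True show ?thesis by simp
  next
    case False
    then have "card {x. f x \<noteq> 0} > 0" using assms by (auto simp: card_gt_0_iff)
    with False show ?thesis by simp
  qed
  have 3: "card ({x. f x \<noteq> 0} - {e} \<union> (if c = 0 then {} else {e}))
      = card ({x. f x \<noteq> 0} - {e}) + card (if c = 0 then {} else {e})"
    using assms by (intro card_Un_disjoint) auto
  show ?thesis unfolding 1 3 2 by simp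
qed


section \<open>A structured language for the machine\<close>

text \<open>
  \<open>Put l a c\<close> stands for the assignment of \<open>a + c\<close> to \<open>l\<close>, where \<open>c\<close> is a constant. Copying is adding
  0. That nothing else can be computed in one step is essential for the cost bound: values grow at most
  linearly with the number of steps.
\<close>

datatype test = IsPos operand | IsZero operand

datatype com =
    Put location operand int
  | Get location
  | Seq com com (infixr ";;" 60)
  | Cond test com com
  | Loop test com

text \<open>
  The last component is a clock, an upper bound for the number of machine instructions executed so far.
  A branch and a round of a loop advance it by two, for the test and for an unconditional jump.
\<close>

type_synonym state = "(int \<Rightarrow> int) \<times> bool list \<times> nat"

fun holds :: "test \<Rightarrow> (int \<Rightarrow> int) \<Rightarrow> bool" where
  "holds (IsPos a) m \<longleftrightarrow> operand_value m a > 0"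
| "holds (IsZero a) m \<longleftrightarrow> operand_value m a = 0"

inductive run :: "com \<Rightarrow> state \<Rightarrow> state \<Rightarrow> bool" where
  Put: "run (Put l a c) (m, u, t) (m(address m l := operand_value m a + c), u, t + 1)"
| Get: "run (Get l) (m, u, t) (m(address m l := next_symbol u), tl u, t + 1)"
| Seq: "run c1 s s' \<Longrightarrow> run c2 s' s'' \<Longrightarrow> run (c1 ;; c2) s s''"
| CondT: "holds b m \<Longrightarrow> run c1 (m, u, t + 2) s \<Longrightarrow> run (Cond b c1 c2) (m, u, t) s"
| CondF: "\<not> holds b m \<Longrightarrow> run c2 (m, u, t + 2) s \<Longrightarrow> run (Cond b c1 c2) (m, u, t) s"
| LoopT: "holds b m \<Longrightarrow> run c (m, u, t + 2) s \<Longrightarrow> run (Loop b c) s s' \<Longrightarrow> run (Loop b c) (m, u, t) s'"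
| LoopF: "\<not> holds b m \<Longrightarrow> run (Loop b c) (m, u, t) (m, u, t + 2)"

inductive_cases run_PutE: "run (Put l a c) (m, u, t) s'"
inductive_cases run_GetE: "run (Get l) (m, u, t) s'"
inductive_cases run_SeqE: "run (c1 ;; c2) s s'"
inductive_cases run_CondE: "run (Cond b c1 c2) (m, u, t) s'"

lemma run_Put_iff:
  "run (Put l a c) (m, u, t) s \<longleftrightarrow> s = (m(address m l := operand_value m a + c), u, t + 1)"
  by (auto intro: run.Put[simplified] elim: run_PutE)

lemma run_Get_iff:
  "run (Get l) (m, u, t) s \<longleftrightarrow> s = (m(address m l := next_symbol u), tl u, t + 1)"
  by (auto intro: run.Get[simplified] elim: run_GetE)

lemma run_Cond_iff:
  "run (Cond b c1 c2) (m, u, t) s \<longleftrightarrow>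
   (if holds b m then run c1 (m, u, t + 2) s else run c2 (m, u, t + 2) s)"
  by (auto intro: run.CondT[simplified] run.CondF[simplified] elim: run_CondE)

text \<open>
  Total correctness, as weakest precondition. As the clock is part of the state, postconditions also bound
  the running time.
\<close>

definition wp :: "com \<Rightarrow> (state \<Rightarrow> bool) \<Rightarrow> state \<Rightarrow> bool" where
  "wp c Q s \<longleftrightarrow> (\<exists>s'. run c s s' \<and> Q s')"

lemma wp_Put [simp]:
  "wp (Put l a c) Q (m, u, t) = Q (m(address m l := operand_value m a + c), u, t + 1)"
  unfolding wp_def run_Put_iff by blast

lemma wp_Get [simp]:
  "wp (Get l) Q (m, u, t) = Q (m(address m l := next_symbol u), tl u, t + 1)"
  unfolding wp_def run_Get_iff by blast

lemma wp_Seq [simp]: "wp (c1 ;; c2) Q s = wp c1 (wp c2 Q) s"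
  unfolding wp_def by (blast intro: run.Seq elim: run_SeqE)

lemma wp_Cond [simp]:
  "wp (Cond b c1 c2) Q (m, u, t) = (if holds b m then wp c1 Q (m, u, t + 2) else wp c2 Q (m, u, t + 2))"
  unfolding wp_def run_Cond_iff by simp

lemma wp_mono: "wp c Q s \<Longrightarrow> (\<And>s'. Q s' \<Longrightarrow> Q' s') \<Longrightarrow> wp c Q' s"
  unfolding wp_def by blast

text \<open>
  The index of the invariant is the exact number of rounds still to come, and each round takes time at
  most \<open>N\<close>.
\<close>

lemma wp_Loop:
  assumes "\<And>k m u t. Inv (Suc k) m u \<Longrightarrow>
      holds b m \<and> wp c (\<lambda>(m', u', t'). Inv k m' u' \<and> t' \<le> t + N) (m, u, t)"
    and "\<And>m u. Inv 0 m u \<Longrightarrow> \<not> holds b m"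
    and "Inv k m u"
    and "\<And>m' u' t'. Inv 0 m' u' \<Longrightarrow> t' \<le> t + (k * (N + 2) + 2) \<Longrightarrow> Q (m', u', t')"
  shows "wp (Loop b c) Q (m, u, t)"
proof -
  have "\<exists>m' u' t'. run (Loop b c) (m, u, t) (m', u', t') \<and> Inv 0 m' u' \<and> t' \<le> t + (k * (N + 2) + 2)"
    using assms(3)
  proof (induction k arbitrary: m u t)
    case 0
    with assms(2) run.LoopF[of b m c u t] show ?case by fastforce
  next
    case (Suc k)
    from assms(1)[OF Suc.prems, of "t + 2"] obtain m1 u1 t1
      where 1: "holds b m" "run c (m, u, t + 2) (m1, u1, t1)" "Inv k m1 u1" "t1 \<le> t + 2 + N"
      unfolding wp_def by auto
    from Suc.IH[OF 1(3), of t1] obtain m2 u2 t2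
      where "run (Loop b c) (m1, u1, t1) (m2, u2, t2)" "Inv 0 m2 u2" "t2 \<le> t1 + (k * (N + 2) + 2)"
      by blast
    with 1 run.LoopT[OF 1(1,2)] show ?case
      by (intro exI[of _ m2] exI[of _ u2] exI[of _ t2]) auto
  qed
  with assms(4) show ?thesis unfolding wp_def by blast
qed

fun jump_on :: "test \<Rightarrow> nat \<Rightarrow> instr" where
  "jump_on (IsPos a) l = JumpIfPos a l"
| "jump_on (IsZero a) l = JumpIfZero a l"

fun code_length :: "com \<Rightarrow> nat" where
  "code_length (Put l a c) = 1"
| "code_length (Get l) = 1"
| "code_length (c1 ;; c2) = code_length c1 + code_length c2"
| "code_length (Cond b c1 c2) = code_length c1 + code_length c2 + 2"
| "code_length (Loop b c) = code_length c + 3"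

text \<open>
  The first argument is the address of the first instruction, since jumps are absolute. Conditional jumps
  are taken when the test succeeds, so the negative branch comes first, and a loop starts
  with a jump to its body over the jump to its exit.
\<close>

fun compile :: "nat \<Rightarrow> com \<Rightarrow> program" where
  "compile p (Put l a c) = [Arith Add l a (Const c)]"
| "compile p (Get l) = [Read l]"
| "compile p (c1 ;; c2) = compile p c1 @ compile (p + code_length c1) c2"
| "compile p (Cond b c1 c2) =
     [jump_on b (p + code_length c2 + 2)] @ compile (p + 1) c2
     @ [Jump (p + code_length c2 + 2 + code_length c1)] @ compile (p + code_length c2 + 2) c1"
| "compile p (Loop b c) =
     [jump_on b (p + 2), Jump (p + code_length c + 3)] @ compile (p + 2) c @ [Jump p]"

lemma length_compile [simp]: "length (compile p c) = code_length c"
  by (induction p c rule: compile.induct) auto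

text \<open>
  The instructions that \<open>compile\<close> emits, and \<open>Halt\<close>. None of them can exceed the largest value in memory by
  more than a constant.
\<close>

fun plain :: "instr \<Rightarrow> bool" where
  "plain (Move l a) = False"
| "plain (Arith f l a b) = (f = Add \<and> (\<exists>c. b = Const c))"
| "plain _ = True"

lemma plain_compile: "i \<in> set (compile p c) \<Longrightarrow> plain i"
proof -
  have "plain (jump_on b l)" for b l by (cases b) auto
  then show "i \<in> set (compile p c) \<Longrightarrow> plain i"
    by (induction p c rule: compile.induct) auto
qed

inductive steps :: "program \<Rightarrow> nat \<Rightarrow> config \<Rightarrow> config \<Rightarrow> bool" for P where
  none: "steps P 0 c c"
| more: "steps P n (exec (P ! pc c) c) c' \<Longrightarrow> pc c < length P \<Longrightarrow> \<forall>b. P ! pc c \<noteq> Halt b \<Longrightarrow>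
    steps P (Suc n) c c'"

lemma steps_trans: "steps P n c c' \<Longrightarrow> steps P k c' c'' \<Longrightarrow> steps P (n + k) c c''"
  by (induction rule: steps.induct) (auto intro: steps.more)

abbreviation config_at :: "nat \<Rightarrow> (int \<Rightarrow> int) \<Rightarrow> bool list \<Rightarrow> config" where
  "config_at p m u \<equiv> \<lparr>pc = p, mem = m, unread = u\<rparr>"

lemma steps_one:
  assumes "P = pre @ [i] @ post" "length pre = p" "\<forall>b. i \<noteq> Halt b" "exec i (config_at p m u) = c"
  shows "steps P 1 (config_at p m u) c"
proof -
  have "P ! p = i" "p < length P" using assms(1,2) by auto
  then show ?thesis
    using steps.more[where P = P and c = "config_at p m u" and c' = c and n = 0] assms(3,4) steps.none
    by auto
qed

lemma exec_jump_on: "exec (jump_on b l) (config_at p m u) = config_at (if holds b m then l else Suc p) m u"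
  by (cases b) (auto simp: jump_if_def)

lemma jump_on_not_Halt: "jump_on b l \<noteq> Halt v"
  by (cases b) auto

text \<open>
  The clock may run ahead of the machine, because a positive branch needs only one of the two jumps.
\<close>

theorem compile_correct:
  assumes "run c (m, u, t) (m', u', t')" "P = pre @ compile p c @ post" "length pre = p"
  shows "\<exists>n. n + t \<le> t' \<and> steps P n (config_at p m u) (config_at (p + code_length c) m' u')"
  using assms
proof (induction c "(m, u, t)" "(m', u', t')" arbitrary: m u t m' u' t' pre p post rule: run.induct)
  case (Put l a c m u t)
  then have "steps P 1 (config_at p m u) (config_at (Suc p) (m(address m l := operand_value m a + c)) u)"
    by (intro steps_one[of P pre _ post]) (auto simp: store_def)
  then show ?case by (intro exI[of _ 1]) simp
next
  case (Get l m u t)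
  then have "steps P 1 (config_at p m u) (config_at (Suc p) (m(address m l := next_symbol u)) (tl u))"
    by (intro steps_one[of P pre _ post]) (auto simp: store_def)
  then show ?case by (intro exI[of _ 1]) simp
next
  case (Seq c1 s' c2)
  obtain m1 u1 t1 where s': "s' = (m1, u1, t1)" by (cases s')
  from Seq.hyps(2)[OF s', of pre p "compile (p + code_length c1) c2 @ post"] Seq.prems
  obtain n1 where 1: "n1 + t \<le> t1" "steps P n1 (config_at p m u) (config_at (p + code_length c1) m1 u1)"
    by auto
  from Seq.hyps(4)[OF s', of "pre @ compile p c1" "p + code_length c1" post] Seq.prems
  obtain n2 where "n2 + t1 \<le> t'"
    "steps P n2 (config_at (p + code_length c1) m1 u1) (config_at (p + code_length c1 + code_length c2) m' u')"
    by auto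
  with 1 show ?case
    by (intro exI[of _ "n1 + n2"]) (auto intro: steps_trans simp: add.assoc)
next
  case (CondT b m c1 u t c2)
  let ?j = "jump_on b (p + code_length c2 + 2)"
  let ?J = "Jump (p + code_length c2 + 2 + code_length c1)"
  have "steps P 1 (config_at p m u) (config_at (p + code_length c2 + 2) m u)"
    using CondT.prems CondT.hyps(1)
    by (intro steps_one[of P pre ?j]) (auto simp: exec_jump_on jump_on_not_Halt)
  moreover from CondT.hyps(3)[of "pre @ [?j] @ compile (p + 1) c2 @ [?J]" "p + code_length c2 + 2" post] CondT.prems
  obtain n where "n + (t + 2) \<le> t'"
    "steps P n (config_at (p + code_length c2 + 2) m u) (config_at (p + code_length c2 + 2 + code_length c1) m' u')"
    by auto
  ultimately show ?case
    by (intro exI[of _ "1 + n"]) (auto intro: steps_trans[of _ 1, simplified] simp: ac_simps)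
next
  case (CondF b m c2 u t c1)
  let ?j = "jump_on b (p + code_length c2 + 2)"
  let ?J = "Jump (p + code_length c2 + 2 + code_length c1)"
  have 1: "steps P 1 (config_at p m u) (config_at (p + 1) m u)"
    using CondF.prems CondF.hyps(1)
    by (intro steps_one[of P pre ?j]) (auto simp: exec_jump_on jump_on_not_Halt)
  from CondF.hyps(3)[of "pre @ [?j]" "p + 1" "?J # compile (p + code_length c2 + 2) c1 @ post"] CondF.prems
  obtain n where n: "n + (t + 2) \<le> t'" "steps P n (config_at (p + 1) m u) (config_at (p + 1 + code_length c2) m' u')"
    by auto
  have 2: "steps P 1 (config_at (p + 1 + code_length c2) m' u') (config_at (p + code_length c2 + 2 + code_length c1) m' u')"
    using CondF.prems
    by (intro steps_one[of P "pre @ [?j] @ compile (p + 1) c2" ?J]) (auto simp: jump_if_def)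
  show ?case
    using n(1) steps_trans[OF steps_trans[OF 1 n(2)] 2]
    by (intro exI[of _ "1 + n + 1"]) (auto simp: ac_simps)
next
  case (LoopT b m c u t s)
  obtain m1 u1 t1 where s: "s = (m1, u1, t1)" by (cases s)
  let ?j = "jump_on b (p + 2)" and ?J = "Jump (p + code_length c + 3)"
  have 1: "steps P 1 (config_at p m u) (config_at (p + 2) m u)"
    using LoopT.prems LoopT.hyps(1)
    by (intro steps_one[of P pre ?j]) (auto simp: exec_jump_on jump_on_not_Halt)
  from LoopT.hyps(3)[OF s, of "pre @ [?j, ?J]" "p + 2" "Jump p # post"] LoopT.prems
  obtain n1 where n1: "n1 + (t + 2) \<le> t1" "steps P n1 (config_at (p + 2) m u) (config_at (p + 2 + code_length c) m1 u1)"
    by auto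
  have 2: "steps P 1 (config_at (p + 2 + code_length c) m1 u1) (config_at p m1 u1)"
    using LoopT.prems
    by (intro steps_one[of P "pre @ [?j, ?J] @ compile (p + 2) c" "Jump p"]) (auto simp: jump_if_def)
  from LoopT.hyps(5)[OF s, of pre p post] LoopT.prems
  obtain n2 where n2: "n2 + t1 \<le> t'" "steps P n2 (config_at p m1 u1) (config_at (p + code_length (Loop b c)) m' u')"
    by auto
  show ?case
    using n1(1) n2(1) steps_trans[OF steps_trans[OF steps_trans[OF 1 n1(2)] 2] n2(2)]
    by (intro exI[of _ "1 + n1 + 1 + n2"]) auto
next
  case (LoopF b m c u t)
  let ?j = "jump_on b (p + 2)" and ?J = "Jump (p + code_length c + 3)"
  have 1: "steps P 1 (config_at p m u) (config_at (Suc p) m u)"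
    using LoopF.prems LoopF.hyps(1)
    by (intro steps_one[of P pre ?j]) (auto simp: exec_jump_on jump_on_not_Halt)
  have 2: "steps P 1 (config_at (Suc p) m u) (config_at (p + code_length c + 3) m u)"
    using LoopF.prems
    by (intro steps_one[of P "pre @ [?j]" ?J]) (auto simp: jump_if_def)
  show ?case
    using steps_trans[OF 1 2] by (intro exI[of _ "1 + 1"]) (auto simp: ac_simps)
qed

section \<open>Costs of programs that only add constants\<close>

text \<open>
  \<open>D\<close> bounds the addresses and constants that are written in an instruction.
\<close>

fun loc_within :: "nat \<Rightarrow> location \<Rightarrow> bool" where
  "loc_within D (Cell i) \<longleftrightarrow> \<bar>i\<bar> \<le> int D"
| "loc_within D (Ind i) \<longleftrightarrow> \<bar>i\<bar> \<le> int D"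

fun op_within :: "nat \<Rightarrow> operand \<Rightarrow> bool" where
  "op_within D (Const c) \<longleftrightarrow> \<bar>c\<bar> \<le> int D"
| "op_within D (Val l) \<longleftrightarrow> loc_within D l"

fun instr_within :: "nat \<Rightarrow> instr \<Rightarrow> bool" where
  "instr_within D (Read l) \<longleftrightarrow> loc_within D l"
| "instr_within D (Arith f l a b) \<longleftrightarrow> loc_within D l \<and> op_within D a \<and> op_within D b"
| "instr_within D (JumpIfZero a l) \<longleftrightarrow> op_within D a"
| "instr_within D (JumpIfPos a l) \<longleftrightarrow> op_within D a"
| "instr_within D _ \<longleftrightarrow> True"

lemma instr_within_mono: "instr_within D i \<Longrightarrow> D \<le> D' \<Longrightarrow> instr_within D' i"
proof -
  assume D: "D \<le> D'"
  have l: "loc_within D l \<Longrightarrow> loc_within D' l" for l using D by (cases l) auto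
  then have "op_within D a \<Longrightarrow> op_within D' a" for a using D by (cases a) auto
  with l show "instr_within D i \<Longrightarrow> instr_within D' i" by (cases i) auto
qed

lemma instr_within_exists: "\<exists>D\<ge>1. \<forall>i\<in>set P. instr_within D i"
proof (induction P)
  case (Cons i P)
  have z: "\<exists>D. \<bar>z\<bar> \<le> int D" for z :: int by (rule exI[of _ "nat \<bar>z\<bar>"]) simp
  have l: "\<exists>D. loc_within D l" for l using z by (cases l) simp_all
  have a: "\<exists>D. op_within D a" for a using z l by (cases a) simp_all
  have lm: "loc_within D l \<Longrightarrow> D \<le> D' \<Longrightarrow> loc_within D' l" for D D' l by (cases l) auto
  have am: "op_within D a \<Longrightarrow> D \<le> D' \<Longrightarrow> op_within D' a" for D D' a using lm by (cases a) auto
  have "\<exists>D. instr_within D i"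
  proof (cases i)
    case (Arith f l b c)
    obtain D1 D2 D3 where "loc_within D1 l" "op_within D2 b" "op_within D3 c"
      using l[of l] a[of b] a[of c] by blast
    then have "instr_within (D1 + D2 + D3) i"
      using Arith lm[of D1 l "D1 + D2 + D3"] am[of D2 b "D1 + D2 + D3"] am[of D3 c "D1 + D2 + D3"] by simp
    then show ?thesis by blast
  qed (use l a in simp_all)
  then obtain D where D: "instr_within D i" by blast
  from Cons obtain D' where D': "D' \<ge> 1" "\<forall>i\<in>set P. instr_within D' i" by blast
  have "\<forall>i\<in>set (i # P). instr_within (D + D') i"
    using D D'(2) instr_within_mono[of D i "D + D'"] instr_within_mono[of D' _ "D + D'"] by auto
  with D'(1) show ?case by (intro exI[of _ "D + D'"]) simp
next
  case Nil
  show ?case by (intro exI[of _ 1]) simp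
qed

definition bounded_mem :: "nat \<Rightarrow> (int \<Rightarrow> int) \<Rightarrow> bool" where
  "bounded_mem V m \<longleftrightarrow> (\<forall>a. \<bar>m a\<bar> \<le> int V)"

lemma bit_size_le: "\<bar>z\<bar> \<le> int V \<Longrightarrow> bit_size z \<le> bit_size (int V)"
  unfolding bit_size_def by (auto intro!: floorlog_mono)

lemma operand_value_bound:
  "bounded_mem V m \<Longrightarrow> op_within D a \<Longrightarrow> D \<le> V \<Longrightarrow> \<bar>operand_value m a\<bar> \<le> int V"
  by (cases a) (auto simp: bounded_mem_def)

lemma cost_address:
  "bounded_mem V m \<Longrightarrow> loc_within D l \<Longrightarrow> D \<le> V \<Longrightarrow> address_cost m l \<le> 2 * bit_size (int V)"
proof (cases l)
  case (Cell i)
  assume "loc_within D l" "D \<le> V"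
  then have "bit_size i \<le> bit_size (int V)" using Cell by (intro bit_size_le) simp
  then show ?thesis using Cell by simp
next
  case (Ind i)
  assume *: "bounded_mem V m" "loc_within D l" "D \<le> V"
  have "bit_size i \<le> bit_size (int V)" using * Ind by (intro bit_size_le) simp
  moreover have "bit_size (m i) \<le> bit_size (int V)"
    using * by (intro bit_size_le) (simp add: bounded_mem_def)
  ultimately show ?thesis using Ind by simp
qed

lemma cost_operand:
  "bounded_mem V m \<Longrightarrow> op_within D a \<Longrightarrow> D \<le> V \<Longrightarrow> operand_cost m a \<le> 3 * bit_size (int V)"
proof (cases a)
  case (Const c)
  assume "op_within D a" "D \<le> V"
  then have "bit_size c \<le> bit_size (int V)" using Const by (intro bit_size_le) auto
  then show ?thesis using Const by simp
next
  case (Val l)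
  assume *: "bounded_mem V m" "op_within D a" "D \<le> V"
  have "address_cost m l \<le> 2 * bit_size (int V)" using cost_address * Val by auto
  moreover have "bit_size (m (address m l)) \<le> bit_size (int V)"
    using * by (intro bit_size_le) (auto simp: bounded_mem_def)
  ultimately show ?thesis using Val by simp
qed

text \<open>
  With numbers of bit size \<open>b\<close>, an addition costs at most \<open>9 * b\<close>: one for the instruction, \<open>3 * b\<close> for
  fetching an operand through a pointer, \<open>b\<close> for the constant, \<open>b\<close> for adding and \<open>3 * b\<close> for storing. The
  other instructions cost less.
\<close>

lemma plain_step:
  assumes "plain i" "instr_within D i" "1 \<le> D" "D \<le> V" "bounded_mem V (mem c)"
  shows "bounded_mem (V + D) (mem (exec i c))"
    and "cost i c \<le> 9 * bit_size (int (V + D))"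
proof -
  let ?b = "bit_size (int (V + D))"
  have VD: "bounded_mem (V + D) (mem c)" "D \<le> V + D"
    using assms by (auto simp: bounded_mem_def intro: order_trans)
  have b: "1 \<le> ?b" by (simp add: bit_size_def)
  have st: "store_cost (mem c) l v \<le> 3 * ?b" if "loc_within D l" "\<bar>v\<bar> \<le> int (V + D)" for l v
    using cost_address[OF VD(1) that(1) VD(2)] bit_size_le[OF that(2)] by (simp add: store_cost_def)
  have sym: "\<bar>next_symbol u\<bar> \<le> int (V + D)" for u
    using assms by (auto simp: next_symbol_def split: list.splits)
  show "bounded_mem (V + D) (mem (exec i c))"
    using assms(1,2)
  proof (cases i)
    case (Read l)
    then show ?thesis using VD sym by (auto simp: bounded_mem_def store_def)
  next
    case (Arith f l a k)
    then obtain z where k: "f = Add" "k = Const z" "\<bar>z\<bar> \<le> int D" using assms by auto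
    have "\<bar>operand_value (mem c) a\<bar> \<le> int V"
      using operand_value_bound assms Arith by auto
    then have "\<bar>operand_value (mem c) a + z\<bar> \<le> int (V + D)" using k(3) by simp
    then show ?thesis using VD Arith k by (auto simp: bounded_mem_def store_def)
  qed (use VD in \<open>auto simp: jump_if_def\<close>)
  show "cost i c \<le> 9 * ?b"
    using assms(1,2)
  proof (cases i)
    case (Read l)
    then have "store_cost (mem c) l (next_symbol (unread c)) \<le> 3 * ?b"
      using st[OF _ sym] assms(2) by simp
    then show ?thesis using Read b by simp
  next
    case (Arith f l a k)
    then obtain z where k: "f = Add" "k = Const z" "\<bar>z\<bar> \<le> int D" using assms by auto
    have v: "\<bar>operand_value (mem c) a\<bar> \<le> int V"
      using operand_value_bound assms Arith by auto
    then have "\<bar>operand_value (mem c) a + z\<bar> \<le> int (V + D)" using k(3) by simp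
    then have "store_cost (mem c) l (operand_value (mem c) a + z) \<le> 3 * ?b"
      using st Arith assms(2) by auto
    moreover have "operand_cost (mem c) a \<le> 3 * ?b"
      using cost_operand[OF VD(1) _ VD(2)] Arith assms(2) by auto
    moreover have "bit_size z \<le> ?b" "bit_size (operand_value (mem c) a) \<le> ?b"
      using k(3) v bit_size_le[of z "V + D"] bit_size_le[of "operand_value (mem c) a" "V + D"] by auto
    ultimately show ?thesis using Arith k b by (simp add: Let_def)
  next
    case (JumpIfZero a l)
    then show ?thesis using cost_operand[OF VD(1) _ VD(2), of a] assms(2) b by simp
  next
    case (JumpIfPos a l)
    then show ?thesis using cost_operand[OF VD(1) _ VD(2), of a] assms(2) b by simp
  qed (use b in simp_all)
qed

text \<open>
  Each step raises the bound on memory by \<open>D\<close>, so \<open>W\<close> bounds all numbers that occur during the run.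
\<close>

lemma computes_of_steps:
  assumes "steps P n c c'" "\<And>i. i \<in> set P \<Longrightarrow> plain i \<and> instr_within D i" "1 \<le> D"
    and "bounded_mem V (mem c)" "D \<le> V" "V + n * D \<le> W"
    and "pc c' < length P" "P ! pc c' = Halt b"
  shows "\<exists>t \<le> n * (9 * bit_size (int W)) + 1. computes P c b t"
  using assms
proof (induction arbitrary: V rule: steps.induct)
  case (none c)
  have "computes P c b (cost (Halt b) c)" using none by (intro computes.halt)
  then show ?case by auto
next
  case (more n c c')
  let ?i = "P ! pc c"
  have i: "plain ?i" "instr_within D ?i" using more.prems(1) more.hyps(2) by auto
  have V: "D \<le> V + D" "V + D + n * D \<le> W" using more.prems by auto
  from more.IH[OF more.prems(1,2) plain_step(1)[OF i more.prems(2,4,3)] V more.prems(6,7)]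
  obtain t where t: "t \<le> n * (9 * bit_size (int W)) + 1" "computes P (exec ?i c) b t" by blast
  have "cost ?i c \<le> 9 * bit_size (int W)"
    using plain_step(2)[OF i more.prems(2,4,3)] bit_size_le[of "int (V + D)" W] V(2) by simp
  with t computes.step[OF more.hyps(2) refl more.hyps(3) t(2)] show ?case
    by (intro exI[of _ "cost ?i c + t"]) auto
qed


section \<open>Memory layout\<close>

text \<open>
  The cells from address 0 on form records of \<open>r + 4\<close> cells, one for each prefix; \<open>loc r i a\<close> is
  the field \<open>a\<close> of the record of the prefix of length \<open>i\<close>. Field 0 holds the number of the prefix,
  field 1 the edge of the step that follows it, fields 2 and 3 the generator and the sign of the next letter.
  Field \<open>3 + g\<close> is the counter of the edge \<open>(i, g)\<close>. Prefixes are represented by the address of their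
  record and edges by the address of their counter, so that no multiplication is needed to find a
  counter. Registers have negative addresses and hence never collide with records.
\<close>

definition stride :: "nat \<Rightarrow> int" where
  "stride r = int r + 4"

definition loc :: "nat \<Rightarrow> nat \<Rightarrow> nat \<Rightarrow> int" where
  "loc r i a = int i * stride r + int a"

lemma loc_nonneg [simp]: "0 \<le> loc r i a"
  by (simp add: loc_def stride_def)

lemma loc_neq_neg [simp]: "x < 0 \<Longrightarrow> loc r i a \<noteq> x" "x < 0 \<Longrightarrow> x \<noteq> loc r i a"
  using loc_nonneg[of r i a] by linarith+

lemma loc_add [simp]:
  "loc r i 0 + 1 = loc r i (Suc 0)" "loc r i 0 + 2 = loc r i 2" "loc r i 0 + 3 = loc r i 3"
  "loc r i 3 + int b = loc r i (3 + b)"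
  by (simp_all add: loc_def)

lemma loc_stride [simp]: "loc r i 0 + stride r = loc r (Suc i) 0" "loc r (Suc i) 0 - stride r = loc r i 0"
  by (simp_all add: loc_def algebra_simps)

lemma loc_0 [simp]: "loc r 0 0 = 0"
  by (simp add: loc_def)

lemma loc_pos_iff [simp]: "0 < loc r i 0 \<longleftrightarrow> 0 < i" "loc r i 0 = 0 \<longleftrightarrow> i = 0"
  by (auto simp: loc_def stride_def zero_less_mult_iff)

lemma loc_eq_iff:
  assumes "a < r + 4" "b < r + 4"
  shows "loc r i a = loc r j b \<longleftrightarrow> i = j \<and> a = b"
proof
  assume eq: "loc r i a = loc r j b"
  have "(a + i * (r + 4)) div (r + 4) = i" "(b + j * (r + 4)) div (r + 4) = j"
    using assms by simp_all
  moreover have "int (a + i * (r + 4)) = int (b + j * (r + 4))"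
    using eq by (simp add: loc_def stride_def algebra_simps)
  then have "a + i * (r + 4) = b + j * (r + 4)" by (simp only: of_nat_eq_iff)
  ultimately show "i = j \<and> a = b" by (metis add_right_cancel)
qed simp

definition slot :: "nat \<Rightarrow> nat \<times> nat \<Rightarrow> int" where
  "slot r e = loc r (fst e) (3 + snd e)"

definition edges :: "nat \<Rightarrow> (nat \<times> nat) set" where
  "edges r = UNIV \<times> {1..r}"

lemma slot_eq_iff [simp]: "e \<in> edges r \<Longrightarrow> e' \<in> edges r \<Longrightarrow> slot r e = slot r e' \<longleftrightarrow> e = e'"
  by (auto simp: slot_def edges_def loc_eq_iff prod_eq_iff)

lemma slot_neq_neg [simp]: "x < 0 \<Longrightarrow> slot r e \<noteq> x" "x < 0 \<Longrightarrow> x \<noteq> slot r e"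
  by (simp_all add: slot_def)

lemma slot_neq_loc [simp]:
  "e \<in> edges r \<Longrightarrow> a < 4 \<Longrightarrow> slot r e \<noteq> loc r i a" "e \<in> edges r \<Longrightarrow> a < 4 \<Longrightarrow> loc r i a \<noteq> slot r e"
  by (auto simp: slot_def edges_def loc_eq_iff)

locale machine_word =
  fixes r :: nat and w :: "letter list"
  assumes w: "w \<in> words r"
begin

lemma nth_letter: "t < length w \<Longrightarrow> w ! t \<in> letters r"
  using w by auto

lemma step_edge_in [simp]: "t < length w \<Longrightarrow> step_edge w k t \<in> edges r"
  using nth_letter[of t] by (auto simp: step_edge_def edges_def letters_def mem_Times_iff)

text \<open>
  These predicates describe the four kinds of data in memory. The simplification rules below state which
  of them survive which assignment; with these rules, programs are verified without
  reasoning about addresses.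
\<close>

definition letters_at :: "nat set \<Rightarrow> (int \<Rightarrow> int) \<Rightarrow> bool" where
  "letters_at T m \<longleftrightarrow>
     (\<forall>t\<in>T. m (loc r t 2) = int (fst (w ! t)) \<and> m (loc r t 3) = of_bool (snd (w ! t)))"

definition idents_at :: "nat set \<Rightarrow> nat \<Rightarrow> (int \<Rightarrow> int) \<Rightarrow> bool" where
  "idents_at T k m \<longleftrightarrow> (\<forall>t\<in>T. m (loc r t 0) = loc r (ident w k t) 0)"

definition edges_at :: "nat set \<Rightarrow> nat \<Rightarrow> (int \<Rightarrow> int) \<Rightarrow> bool" where
  "edges_at T k m \<longleftrightarrow> (\<forall>t\<in>T. m (loc r t 1) = slot r (step_edge w k t))"

definition counters :: "(nat \<times> nat \<Rightarrow> int) \<Rightarrow> (int \<Rightarrow> int) \<Rightarrow> bool" where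
  "counters f m \<longleftrightarrow> (\<forall>e\<in>edges r. m (slot r e) = f e)"

lemma upd_register [simp]:
  assumes "x < 0"
  shows "letters_at T (m(x := y)) = letters_at T m" "idents_at T k (m(x := y)) = idents_at T k m"
    "edges_at T k (m(x := y)) = edges_at T k m" "counters f (m(x := y)) = counters f m"
  using assms by (simp_all add: letters_at_def idents_at_def edges_at_def counters_def)

lemma upd_slot [simp]:
  assumes "e \<in> edges r"
  shows "letters_at T (m(slot r e := y)) = letters_at T m"
    "idents_at T k (m(slot r e := y)) = idents_at T k m"
    "edges_at T k (m(slot r e := y)) = edges_at T k m"
    "counters f m \<Longrightarrow> counters (f(e := y)) (m(slot r e := y))"
  using assms by (simp_all add: letters_at_def idents_at_def edges_at_def counters_def)

lemma upd_edge [simp]: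
  "letters_at T (m(loc r t (Suc 0) := y)) = letters_at T m"
  "idents_at T k (m(loc r t (Suc 0) := y)) = idents_at T k m"
  "counters f (m(loc r t (Suc 0) := y)) = counters f m"
  "edges_at T k m \<Longrightarrow> edges_at (insert t T) k (m(loc r t (Suc 0) := slot r (step_edge w k t)))"
  by (auto simp: letters_at_def idents_at_def edges_at_def counters_def loc_eq_iff)

lemma upd_ident [simp]:
  "letters_at T (m(loc r t 0 := y)) = letters_at T m"
  "edges_at T k (m(loc r t 0 := y)) = edges_at T k m"
  "counters f (m(loc r t 0 := y)) = counters f m"
  "idents_at T k m \<Longrightarrow> idents_at (insert t T) k (m(loc r t 0 := loc r (ident w k t) 0))"
  by (auto simp: letters_at_def idents_at_def edges_at_def counters_def loc_eq_iff)

end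


section \<open>The program\<close>

text \<open>
  \<open>END\<close> points to the last record, \<open>CUR\<close> to the prefix being processed, \<open>SCAN\<close> to the prefix with which
  it is compared, \<open>FIELD\<close> to a field of either record and \<open>EDGE\<close> to a counter. \<open>NZ\<close> is the number of nonzero
  counters, and \<open>BEST\<close> points to the earliest prefix found so far that has the same flow.
\<close>

abbreviation BIT :: int where "BIT \<equiv> -2"
abbreviation GEN :: int where "GEN \<equiv> -3"
abbreviation SGN :: int where "SGN \<equiv> -4"
abbreviation END :: int where "END \<equiv> -5"
abbreviation CUR :: int where "CUR \<equiv> -6"
abbreviation SCAN :: int where "SCAN \<equiv> -7"
abbreviation FIELD :: int where "FIELD \<equiv> -8"
abbreviation EDGE :: int where "EDGE \<equiv> -9"
abbreviation CNT :: int where "CNT \<equiv> -10"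
abbreviation NZ :: int where "NZ \<equiv> -11"
abbreviation BEST :: int where "BEST \<equiv> -12"

abbreviation reg :: "int \<Rightarrow> operand" where "reg x \<equiv> Val (Cell x)"
abbreviation deref :: "int \<Rightarrow> operand" where "deref x \<equiv> Val (Ind x)"

definition skip :: com where "skip = Put (Cell FIELD) (reg FIELD) 0"

lemma wp_skip [simp]: "wp skip Q (m, u, t) = Q (m, u, t + 1)"
  by (simp add: skip_def)

text \<open>
  A decision tree over the bits of a code word. The machine does not store the code: each leaf of the
  tree knows its letter. At leaves whose path is not a code word the value of \<open>the_inv_into\<close> is
  arbitrary; they are never reached.
\<close>

fun decode :: "nat \<Rightarrow> (letter \<Rightarrow> bool list) \<Rightarrow> nat \<Rightarrow> bool list \<Rightarrow> com" where
  "decode r code 0 bs =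
     (let x = the_inv_into (letters r) code bs in
        Put (Cell GEN) (Const (int (fst x))) 0 ;; Put (Cell SGN) (Const (of_bool (snd x))) 0)"
| "decode r code (Suc k) bs =
     Get (Cell BIT) ;;
     Cond (IsPos (reg BIT)) (decode r code k (bs @ [True])) (decode r code k (bs @ [False]))"

lemma wp_decode:
  assumes code: "inj_on code (letters r)" "x \<in> letters r"
    and "code x = bs @ ds"
    and "\<And>b t'. t' \<le> t + (3 * length ds + 2) \<Longrightarrow>
      Q (m(BIT := b, GEN := int (fst x), SGN := of_bool (snd x)), u, t')"
  shows "wp (decode r code (length ds) bs) Q (m, ds @ u, t)"
  using assms(3,4)
proof (induction ds arbitrary: bs m t)
  case Nil
  have "the_inv_into (letters r) code bs = x"
    using the_inv_into_f_f[OF code] Nil(1) by simp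
  moreover have "Q (m(BIT := m BIT, GEN := int (fst x), SGN := of_bool (snd x)), u, t + 2)"
    by (rule Nil(2)) simp
  ultimately show ?case
    by (simp only: fun_upd_triv list.size decode.simps Let_def wp_Seq wp_Put operand_value.simps
        address.simps add_0_right add.assoc one_add_one append_Nil)
next
  case (Cons d ds)
  have "wp (decode r code (length ds) (bs @ [d])) Q (m(BIT := of_bool d), ds @ u, t + 3)"
  proof (rule Cons.IH)
    show "code x = (bs @ [d]) @ ds" using Cons.prems by simp
    show "Q ((m(BIT := of_bool d))(BIT := b, GEN := int (fst x), SGN := of_bool (snd x)), u, t')"
      if "t' \<le> t + 3 + (3 * length ds + 2)" for b t'
      unfolding fun_upd_upd by (rule Cons.prems(2)) (use that in simp)
  qed
  then show ?case by (cases d) (simp_all add: next_symbol_def numeral_3_eq_3)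
qed

text \<open>
  Adding 1 to the symbol read makes the end of the input the only case that is not positive.
\<close>

definition fetch :: com where
  "fetch = Get (Cell BIT) ;; Put (Cell BIT) (reg BIT) 1"

definition store_letter :: "nat \<Rightarrow> com" where
  "store_letter r =
     Put (Cell FIELD) (reg CUR) 2 ;; Put (Ind FIELD) (reg GEN) 0 ;;
     Put (Cell FIELD) (reg CUR) 3 ;; Put (Ind FIELD) (reg SGN) 0 ;;
     Put (Cell CUR) (reg CUR) (stride r)"

definition read_letter :: "nat \<Rightarrow> (letter \<Rightarrow> bool list) \<Rightarrow> nat \<Rightarrow> com" where
  "read_letter r code k =
     Put (Cell BIT) (reg BIT) (-1) ;;
     Cond (IsPos (reg BIT)) (decode r code k [True]) (decode r code k [False]) ;;
     store_letter r ;; fetch"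

definition read_word :: "nat \<Rightarrow> (letter \<Rightarrow> bool list) \<Rightarrow> nat \<Rightarrow> com" where
  "read_word r code k =
     fetch ;; Loop (IsPos (reg BIT)) (read_letter r code k) ;; Put (Cell END) (reg CUR) 0"

text \<open>
  Adding a generator to a pointer would be an addition of two variables. Generators are at most \<open>r\<close>, so
  counting is fast enough.
\<close>

definition add_count :: com where
  "add_count = Loop (IsPos (reg CNT)) (Put (Cell EDGE) (reg EDGE) 1 ;; Put (Cell CNT) (reg CNT) (-1))"

lemma wp_add_count:
  assumes "m CNT = int g"
    and "\<And>t'. t' \<le> t + (4 * g + 2) \<Longrightarrow> Q (m(EDGE := m EDGE + int g, CNT := 0), u, t')"
  shows "wp add_count Q (m, u, t)"
  unfolding add_count_def
proof (rule wp_Loop[where N = 2 and k = g and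
      Inv = "\<lambda>k m' u'. u' = u \<and> k \<le> g \<and> m' = m(EDGE := m EDGE + int (g - k), CNT := int k)"])
  show "u = u \<and> g \<le> g \<and> m = m(EDGE := m EDGE + int (g - g), CNT := int g)"
    using assms(1) by (auto simp: fun_eq_iff)
next
  fix m' u' t'
  assume "u' = u \<and> 0 \<le> g \<and> m' = m(EDGE := m EDGE + int (g - 0), CNT := int 0)"
    "t' \<le> t + (g * (2 + 2) + 2)"
  then show "Q (m', u', t')" using assms(2)[of t'] by simp
qed (auto simp: fun_eq_iff of_nat_diff)

text \<open>
  The edge of a step is named after the prefix before a generator and after the prefix behind an inverse
  generator. Numbers of prefixes are addresses of records, so adding \<open>3\<close> and the generator gives the
  address of the counter.
\<close>

definition edge_step :: "nat \<Rightarrow> com" where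
  "edge_step r =
     Put (Cell CUR) (reg CUR) (- stride r) ;;
     Put (Cell FIELD) (reg CUR) 3 ;;
     Cond (IsPos (deref FIELD))
       (Put (Cell EDGE) (deref CUR) 3)
       (Put (Cell FIELD) (reg CUR) (stride r) ;; Put (Cell EDGE) (deref FIELD) 3) ;;
     Put (Cell FIELD) (reg CUR) 2 ;; Put (Cell CNT) (deref FIELD) 0 ;; add_count ;;
     Put (Cell FIELD) (reg CUR) 1 ;; Put (Ind FIELD) (reg EDGE) 0"

definition compute_edges :: "nat \<Rightarrow> com" where
  "compute_edges r = Put (Cell CUR) (reg END) 0 ;; Loop (IsPos (reg CUR)) (edge_step r)"

text \<open>
  The tests of the counter before and after its change implement \<open>card_support_upd\<close>.
\<close>

definition walk_step :: "nat \<Rightarrow> com" where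
  "walk_step r =
     Put (Cell SCAN) (reg SCAN) (- stride r) ;;
     Put (Cell FIELD) (reg SCAN) 1 ;; Put (Cell EDGE) (deref FIELD) 0 ;;
     Cond (IsZero (deref EDGE)) (Put (Cell NZ) (reg NZ) 1) skip ;;
     Put (Cell FIELD) (reg SCAN) 3 ;;
     Cond (IsPos (deref FIELD)) (Put (Ind EDGE) (deref EDGE) 1) (Put (Ind EDGE) (deref EDGE) (-1)) ;;
     Cond (IsZero (deref EDGE)) (Put (Cell NZ) (reg NZ) (-1)) skip ;;
     Cond (IsZero (reg NZ)) (Put (Cell BEST) (reg SCAN) 0) skip"

definition walk :: "nat \<Rightarrow> com" where
  "walk r =
     Put (Cell SCAN) (reg CUR) 0 ;; Put (Cell BEST) (reg CUR) 0 ;; Put (Cell NZ) (Const 0) 0 ;;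
     Loop (IsPos (reg SCAN)) (walk_step r)"

text \<open>
  Only edges used on the walk can have nonzero counters, so going over them once more resets all counters.
\<close>

definition clear_step :: "nat \<Rightarrow> com" where
  "clear_step r =
     Put (Cell SCAN) (reg SCAN) (- stride r) ;;
     Put (Cell FIELD) (reg SCAN) 1 ;; Put (Cell EDGE) (deref FIELD) 0 ;;
     Put (Ind EDGE) (Const 0) 0"

definition clear :: "nat \<Rightarrow> com" where
  "clear r = Put (Cell SCAN) (reg CUR) 0 ;; Loop (IsPos (reg SCAN)) (clear_step r)"

definition ident_step :: "nat \<Rightarrow> com" where
  "ident_step r =
     walk r ;; Put (Ind CUR) (reg BEST) 0 ;; clear r ;; Put (Cell CUR) (reg CUR) (- stride r)"

definition compute_idents :: "nat \<Rightarrow> com" where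
  "compute_idents r = Put (Cell CUR) (reg END) 0 ;; Loop (IsPos (reg CUR)) (ident_step r)"

definition next_level :: "nat \<Rightarrow> com" where
  "next_level r = compute_edges r ;; compute_idents r"

fun levels :: "nat \<Rightarrow> nat \<Rightarrow> com" where
  "levels r 0 = skip"
| "levels r (Suc d) = levels r d ;; next_level r"



section \<open>Correctness and step count of the program\<close>

context machine_word
begin

abbreviation n :: nat where "n \<equiv> length w"

lemma wp_compute_edges:
  assumes m: "letters_at {..<n} m" "idents_at {..n} k m" "counters f m" "m END = loc r n 0"
    and Q: "\<And>m' t'. letters_at {..<n} m' \<Longrightarrow> idents_at {..n} k m' \<Longrightarrow> edges_at {..<n} k m' \<Longrightarrow>
      counters f m' \<Longrightarrow> m' END = loc r n 0 \<Longrightarrow> t' \<le> t + (n * (4 * r + 20) + 3) \<Longrightarrow> Q (m', u, t')"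
  shows "wp (compute_edges r) Q (m, u, t)"
proof -
  let ?I = "\<lambda>i m' u'. i \<le> n \<and> u' = u \<and> m' CUR = loc r i 0 \<and> letters_at {..<n} m' \<and>
    idents_at {..n} k m' \<and> edges_at {i..<n} k m' \<and> counters f m' \<and> m' END = loc r n 0"
  show ?thesis
    unfolding compute_edges_def wp_Seq wp_Put
  proof (rule wp_Loop[where Inv = ?I and k = n and N = "4 * r + 18"])
    fix i m u' t
    assume I: "?I (Suc i) m u'"
    then have i: "i < n" by simp
    have g: "m (loc r i 2) = int (fst (w ! i))" "m (loc r i 3) = of_bool (snd (w ! i))"
      using I i by (auto simp: letters_at_def)
    have id: "m (loc r i 0) = loc r (ident w k i) 0" "m (loc r (Suc i) 0) = loc r (ident w k (Suc i)) 0"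
      using I i by (auto simp: idents_at_def)
    have r: "fst (w ! i) \<le> r" using nth_letter[OF i] by (auto simp: letters_def)
    have ins: "insert i {Suc i..<n} = {i..<n}" using i by auto
    have E: "slot r (step_edge w k i) = loc r (ident w k (if snd (w ! i) then i else Suc i)) (3 + fst (w ! i))"
      by (simp add: step_edge_def slot_def)
    have upd: "edges_at {i..<n} k (m'(loc r i (Suc 0) := slot r (step_edge w k i)))"
      if "edges_at {Suc i..<n} k m'" for m'
      using upd_edge(4)[OF that, of i] ins by simp
    show "holds (IsPos (reg CUR)) m \<and>
      wp (edge_step r)
       (\<lambda>(m', u', t'). ?I i m' u' \<and> t' \<le> t + (4 * r + 18)) (m, u', t)"
      unfolding edge_step_def using I i g id r E upd
      by (cases "snd (w ! i)") (auto intro!: wp_add_count[where g = "fst (w ! i)"])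
  next
    show "?I n (m(address m (Cell CUR) := operand_value m (reg END) + 0)) u"
      using m by (auto simp: edges_at_def)
  qed (use Q in \<open>auto simp: algebra_simps lessThan_atLeast0\<close>)
qed

text \<open>
  At the prefix \<open>j\<close>, the counters hold the flow of the prefix \<open>i\<close> minus the flow of the prefix \<open>j\<close>. For
  \<open>j = 0\<close> the latter is zero, and \<open>BEST\<close> has become the number of \<open>i\<close> on the next level.
\<close>

lemma wp_walk:
  assumes i: "i \<le> n" "m CUR = loc r i 0"
    and m: "letters_at {..<n} m" "edges_at {..<n} k m" "idents_at T k' m" "counters (\<lambda>_. 0) m"
      "m END = loc r n 0"
    and Q: "\<And>m' t'. m' CUR = loc r i 0 \<Longrightarrow> m' BEST = loc r (ident w (Suc k) i) 0 \<Longrightarrow>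
      letters_at {..<n} m' \<Longrightarrow> edges_at {..<n} k m' \<Longrightarrow> idents_at T k' m' \<Longrightarrow>
      counters (prefix_flow w k i) m' \<Longrightarrow> m' END = loc r n 0 \<Longrightarrow> t' \<le> t + (18 * i + 5) \<Longrightarrow> Q (m', u, t')"
  shows "wp (walk r) Q (m, u, t)"
proof -
  let ?f = "\<lambda>j e. prefix_flow w k i e - prefix_flow w k j e"
  let ?best = "\<lambda>j. LEAST j'. j \<le> j' \<and> prefix_flow w k j' = prefix_flow w k i"
  let ?I = "\<lambda>j m' u'. j \<le> i \<and> u' = u \<and> m' SCAN = loc r j 0 \<and> m' BEST = loc r (?best j) 0 \<and>
    m' NZ = int (card {e. ?f j e \<noteq> 0}) \<and> counters (?f j) m' \<and> m' CUR = loc r i 0 \<and>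
    letters_at {..<n} m' \<and> edges_at {..<n} k m' \<and> idents_at T k' m' \<and> m' END = loc r n 0"
  have finite_support: "finite {e. ?f j e \<noteq> 0}" if "j \<le> i" for j
  proof (rule finite_subset)
    show "{e. ?f j e \<noteq> 0} \<subseteq> step_edge w k ` {..<n}"
    proof
      fix e assume "e \<in> {e. ?f j e \<noteq> 0}"
      then have "prefix_flow w k i e \<noteq> 0 \<or> prefix_flow w k j e \<noteq> 0" by auto
      then show "e \<in> step_edge w k ` {..<n}"
        using prefix_flow_support[of i w k e] prefix_flow_support[of j w k e] i that
        by (metis image_eqI lessThan_iff order.strict_trans2 order.trans)
    qed
  qed simp
  have "wp (Loop (IsPos (reg SCAN)) (walk_step r)) Q
      (m(SCAN := loc r i 0, BEST := loc r i 0, NZ := 0), u, t + 3)"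
  proof (rule wp_Loop[where Inv = ?I and k = i and N = 16])
    fix j m u' t
    assume I: "?I (Suc j) m u'"
    then have j: "j < i" "j < n" using i by auto
    define e where "e = step_edge w k j"
    define s where "s = sign (w ! j)"
    define F where "F = ?f (Suc j) e"
    have e: "e \<in> edges r" using j by (simp add: e_def)
    \<comment> \<open>one step back removes the letter at \<open>j\<close> from the subtracted flow, hence adds its sign\<close>
    have f_upd: "(?f (Suc j))(e := F + s) = ?f j"
      using prefix_flow_Suc[OF j(2), of k] by (auto simp: fun_eq_iff e_def s_def F_def)
    have fin: "finite {e. ?f (Suc j) e \<noteq> 0}" using finite_support j by simp
    have NZ: "int (card {x. ?f j x \<noteq> 0})
        = int (card {x. ?f (Suc j) x \<noteq> 0}) + of_bool (F = 0) - of_bool (F + s = 0)"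
      using card_support_upd[OF fin, of e "F + s"] unfolding f_upd F_def[symmetric] .
    have zero: "int (card {x. ?f j x \<noteq> 0}) = 0 \<longleftrightarrow> prefix_flow w k j = prefix_flow w k i"
      using finite_support[of j] j by (auto simp: fun_eq_iff)
    have best: "?best j = (if prefix_flow w k j = prefix_flow w k i then j else ?best (Suc j))"
    proof (cases "prefix_flow w k j = prefix_flow w k i")
      case True
      then show ?thesis by (auto intro: Least_equality)
    next
      case False
      then have "j \<le> j' \<and> prefix_flow w k j' = prefix_flow w k i \<longleftrightarrow>
          Suc j \<le> j' \<and> prefix_flow w k j' = prefix_flow w k i" for j'
        by (metis Suc_leD le_antisym not_less_eq_eq)
      with False show ?thesis by simp
    qed
    have upd: "counters (?f j) (m'(slot r e := F + s))" if "counters (?f (Suc j)) m'" for m'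
      using upd_slot(4)[OF e that, of "F + s"] unfolding f_upd .
    have reads: "m (loc r j (Suc 0)) = slot r e" "m (loc r j 3) = of_bool (snd (w ! j))" "m (slot r e) = F"
      using I j e by (auto simp: letters_at_def edges_at_def counters_def e_def F_def)
    have s: "s = (if snd (w ! j) then 1 else - 1)" by (simp add: s_def sign_def)
    define z where "z = int (card {x. ?f (Suc j) x \<noteq> 0})"
    have regs: "m SCAN = loc r (Suc j) 0" "m BEST = loc r (?best (Suc j)) 0" "m NZ = z" "counters (?f (Suc j)) m"
        "m CUR = loc r i 0" "letters_at {..<n} m" "edges_at {..<n} k m" "idents_at T k' m" "m END = loc r n 0" "u' = u"
      using I by (auto simp: z_def)
    have zero': "z + of_bool (F = 0) - of_bool (F + s = 0) = 0 \<longleftrightarrow> prefix_flow w k j = prefix_flow w k i"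
      using zero unfolding NZ z_def .
    \<comment> \<open>folding these terms keeps the symbolic execution below from rewriting inside the counters\<close>
    define f where "f = ?f (Suc j)"
    define g where "g = ?f j"
    define P where "P \<longleftrightarrow> prefix_flow w k j = prefix_flow w k i"
    show "holds (IsPos (reg SCAN)) m \<and>
      wp (walk_step r)
       (\<lambda>(m', u', t'). ?I j m' u' \<and> t' \<le> t + 16) (m, u', t)"
      unfolding walk_step_def NZ best z_def[symmetric] f_def[symmetric] g_def[symmetric] P_def[symmetric]
      using regs reads e j upd zero'
      unfolding s f_def[symmetric] g_def[symmetric] P_def[symmetric]
      by (cases "snd (w ! j)"; cases "F = 0"; cases "F + s = 0") (simp_all add: s skip_def)
  next
    have "?best i = i" by (rule Least_equality) auto
    then show "?I i (m(SCAN := loc r i 0, BEST := loc r i 0, NZ := 0)) u"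
      using i m by simp
  next
    fix m' u' t'
    assume I: "?I 0 m' u'" and t': "t' \<le> t + 3 + (i * (16 + 2) + 2)"
    have "?f 0 = prefix_flow w k i" by (simp add: fun_eq_iff)
    then show "Q (m', u', t')" using I t' Q by (simp add: ident_Suc)
  qed auto
  then show ?thesis using i by (simp add: walk_def numeral_3_eq_3)
qed

lemma wp_clear:
  assumes i: "i \<le> n" "m CUR = loc r i 0"
    and m: "letters_at {..<n} m" "edges_at {..<n} k m" "idents_at T k' m" "m END = loc r n 0"
      "counters (prefix_flow w k i) m"
    and Q: "\<And>m' t'. m' CUR = loc r i 0 \<Longrightarrow>
      letters_at {..<n} m' \<Longrightarrow> edges_at {..<n} k m' \<Longrightarrow> idents_at T k' m' \<Longrightarrow>
      counters (\<lambda>_. 0) m' \<Longrightarrow> m' END = loc r n 0 \<Longrightarrow> t' \<le> t + (6 * i + 3) \<Longrightarrow> Q (m', u, t')"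
  shows "wp (clear r) Q (m, u, t)"
proof -
  let ?I = "\<lambda>j m' u'. j \<le> i \<and> u' = u \<and> m' SCAN = loc r j 0 \<and>
    (\<forall>e\<in>edges r. m' (slot r e) \<noteq> 0 \<longrightarrow> (\<exists>t<j. step_edge w k t = e)) \<and> m' CUR = loc r i 0 \<and>
    letters_at {..<n} m' \<and> edges_at {..<n} k m' \<and> idents_at T k' m' \<and> m' END = loc r n 0"
  show ?thesis
    unfolding clear_def wp_Seq wp_Put
  proof (rule wp_Loop[where Inv = ?I and k = i and N = 4])
    fix j m u' t
    assume I: "?I (Suc j) m u'"
    then have j: "j < n" using i by auto
    have e: "m (loc r j (Suc 0)) = slot r (step_edge w k j)" "step_edge w k j \<in> edges r"
      using I j by (auto simp: edges_at_def)
    show "holds (IsPos (reg SCAN)) m \<and>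
      wp (clear_step r)
       (\<lambda>(m', u', t'). ?I j m' u' \<and> t' \<le> t + 4) (m, u', t)"
      using I e by (auto simp: clear_step_def less_Suc_eq)
  next
    show "?I i (m(address m (Cell SCAN) := operand_value m (reg CUR) + 0)) u"
      using i m prefix_flow_support[OF i(1), of k] by (auto simp: counters_def)
  next
    fix m' u' t'
    assume I: "?I 0 m' u'" and t': "t' \<le> t + 1 + (i * (4 + 2) + 2)"
    then have "counters (\<lambda>_. 0) m'" by (auto simp: counters_def)
    then show "Q (m', u', t')" using I t' Q by simp
  qed auto
qed

text \<open>
  The new numbers overwrite the old ones, which have already been used to compute the edges. The empty
  prefix keeps its number 0 and needs no walk.
\<close>

lemma wp_compute_idents:
  assumes m: "letters_at {..<n} m" "edges_at {..<n} k m" "idents_at {..n} k m" "counters (\<lambda>_. 0) m"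
      "m END = loc r n 0"
    and Q: "\<And>m' t'. letters_at {..<n} m' \<Longrightarrow> idents_at {..n} (Suc k) m' \<Longrightarrow> counters (\<lambda>_. 0) m' \<Longrightarrow>
      m' END = loc r n 0 \<Longrightarrow> t' \<le> t + (n * (24 * n + 12) + 3) \<Longrightarrow> Q (m', u, t')"
  shows "wp (compute_idents r) Q (m, u, t)"
proof -
  let ?I = "\<lambda>i m' u'. i \<le> n \<and> u' = u \<and> m' CUR = loc r i 0 \<and> letters_at {..<n} m' \<and>
    edges_at {..<n} k m' \<and> idents_at (insert 0 {Suc i..n}) (Suc k) m' \<and>
    counters (\<lambda>_. 0) m' \<and> m' END = loc r n 0"
  show ?thesis
    unfolding compute_idents_def wp_Seq wp_Put
  proof (rule wp_Loop[where Inv = ?I and k = n and N = "24 * n + 10"])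
    fix i m u' t
    assume I: "?I (Suc i) m u'"
    have "idents_at (insert 0 {Suc i..n}) (Suc k) (m'(loc r (Suc i) 0 := loc r (ident w (Suc k) (Suc i)) 0))"
      if "idents_at (insert 0 {Suc (Suc i)..n}) (Suc k) m'" for m'
    proof -
      have "insert (Suc i) (insert 0 {Suc (Suc i)..n}) = insert 0 {Suc i..n}" using I by auto
      with upd_ident(4)[OF that, of "Suc i"] show ?thesis by simp
    qed
    then show "holds (IsPos (reg CUR)) m \<and>
      wp (ident_step r)
       (\<lambda>(m', u', t'). ?I i m' u' \<and> t' \<le> t + (24 * n + 10)) (m, u', t)"
      unfolding ident_step_def using I
      by (auto intro!: wp_walk[where i = "Suc i" and k = k and T = "insert 0 {Suc (Suc i)..n}" and k' = "Suc k"]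
        wp_clear[where i = "Suc i" and k = k and T = "insert 0 {Suc i..n}" and k' = "Suc k"])
  next
    have "ident w k 0 = 0" "ident w (Suc k) 0 = 0"
      using ident_le[of w k 0] ident_le[of w "Suc k" 0] by simp_all
    moreover have "m (loc r 0 0) = loc r (ident w k 0) 0"
      using m(3) by (simp add: idents_at_def del: loc_0)
    ultimately show "?I n (m(address m (Cell CUR) := operand_value m (reg END) + 0)) u"
      using m by (simp add: idents_at_def)
  next
    fix m' u' t'
    assume I: "?I 0 m' u'" and t': "t' \<le> t + 1 + (n * (24 * n + 10 + 2) + 2)"
    have "insert 0 {Suc 0..n} = {..n}" by auto
    moreover have "t' \<le> t + (n * (24 * n + 12) + 3)" using t' by (simp add: algebra_simps)
    ultimately show "Q (m', u', t')" using I Q by simp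
  qed auto
qed

lemma wp_next_level:
  assumes "letters_at {..<n} m" "idents_at {..n} k m" "counters (\<lambda>_. 0) m" "m END = loc r n 0"
    and Q: "\<And>m' t'. letters_at {..<n} m' \<Longrightarrow> idents_at {..n} (Suc k) m' \<Longrightarrow> counters (\<lambda>_. 0) m' \<Longrightarrow>
      m' END = loc r n 0 \<Longrightarrow> t' \<le> t + (n * (24 * n + 4 * r + 32) + 6) \<Longrightarrow> Q (m', u, t')"
  shows "wp (next_level r) Q (m, u, t)"
  unfolding next_level_def wp_Seq
  using assms(1-4)
  by (auto intro!: wp_compute_edges[where k = k and f = "\<lambda>_. 0"] wp_compute_idents[where k = k] Q
      simp: algebra_simps)

lemma wp_levels:
  assumes "letters_at {..<n} m" "idents_at {..n} 0 m" "counters (\<lambda>_. 0) m" "m END = loc r n 0"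
    and Q: "\<And>m' t'. idents_at {..n} d m' \<Longrightarrow> m' END = loc r n 0 \<Longrightarrow>
      t' \<le> t + (d * (n * (24 * n + 4 * r + 32) + 6) + 1) \<Longrightarrow> Q (m', u, t')"
  shows "wp (levels r d) Q (m, u, t)"
proof -
  let ?N = "n * (24 * n + 4 * r + 32) + 6"
  have "wp (levels r d) (\<lambda>(m', u', t'). u' = u \<and> letters_at {..<n} m' \<and> idents_at {..n} d m' \<and>
    counters (\<lambda>_. 0) m' \<and> m' END = loc r n 0 \<and> t' \<le> t + (d * ?N + 1)) (m, u, t)"
  proof (induction d)
    case (Suc d)
    show ?case
      unfolding levels.simps wp_Seq
      by (rule wp_mono[OF Suc.IH]) (auto intro!: wp_next_level[where k = d])
  qed (use assms in simp)
  then show ?thesis by (rule wp_mono) (use Q in auto)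
qed

lemma wp_fetch [simp]: "wp fetch Q (m, u, t) = Q (m(BIT := next_symbol u + 1), tl u, t + 2)"
  by (simp add: fetch_def)

lemma wp_store_letter:
  assumes "m CUR = loc r i 0" "m GEN = int (fst (w ! i))" "m SGN = of_bool (snd (w ! i))"
    and m: "letters_at {..<i} m" "idents_at T k m" "counters f m"
    and Q: "\<And>m'. letters_at {..<Suc i} m' \<Longrightarrow> idents_at T k m' \<Longrightarrow> counters f m' \<Longrightarrow>
      m' CUR = loc r (Suc i) 0 \<Longrightarrow> Q (m', u, t + 5)"
  shows "wp (store_letter r) Q (m, u, t)"
proof -
  define m' where "m' = m(FIELD := loc r i 2, loc r i 2 := m GEN, FIELD := loc r i 3,
    loc r i 3 := m SGN, CUR := loc r (Suc i) 0)"
  have new: "m' (loc r i 2) = int (fst (w ! i))" "m' (loc r i 3) = of_bool (snd (w ! i))"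
    using assms(2,3) by (simp_all add: m'_def loc_eq_iff)
  have old: "m' x = m x" if "0 \<le> x" "x \<noteq> loc r i 2" "x \<noteq> loc r i 3" for x
    using that by (auto simp: m'_def)
  have "Q (m', u, t + 5)"
  proof (rule Q)
    have "m' (loc r t 2) = m (loc r t 2)" "m' (loc r t 3) = m (loc r t 3)" if "t < i" for t
      using that by (auto intro!: old simp: loc_eq_iff)
    then show "letters_at {..<Suc i} m'"
      using m(1) new unfolding letters_at_def lessThan_Suc by simp
    show "idents_at T k m'" "counters f m'"
      using m(2,3) by (auto simp: idents_at_def counters_def old loc_eq_iff slot_def edges_def)
    show "m' CUR = loc r (Suc i) 0" by (simp add: m'_def)
  qed
  then show ?thesis using assms(1) by (simp add: store_letter_def m'_def numeral_eq_Suc)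
qed

lemma wp_read_letter:
  assumes "m BIT = of_bool b + 1"
    and "wp (decode r code k [b]) (wp (store_letter r ;; fetch) Q) (m(BIT := of_bool b), u, t + 3)"
  shows "wp (read_letter r code k) Q (m, u, t)"
  using assms by (cases b) (simp_all add: read_letter_def numeral_3_eq_3)

text \<open>
  The loop looks one bit ahead to find the end of the input: at its head, the first bit of the code of the
  next letter has already been read. Since the memory is initially zero, all numbers are 0 and all counters
  are cleared from the start.
\<close>

lemma wp_read_word:
  assumes code: "inj_on code (letters r)" "\<And>x. x \<in> letters r \<Longrightarrow> length (code x) = Suc k"
    and m: "\<And>x. 0 \<le> x \<Longrightarrow> m x = 0"
    and Q: "\<And>m' u' t'. letters_at {..<n} m' \<Longrightarrow> idents_at {..n} 0 m' \<Longrightarrow> counters (\<lambda>_. 0) m' \<Longrightarrow>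
      m' END = loc r n 0 \<Longrightarrow> t' \<le> t + (n * (3 * k + 14) + 5) \<Longrightarrow> Q (m', u', t')"
    and "m CUR = 0"
  shows "wp (read_word r code k) Q (m, encode code w, t)"
proof -
  let ?rest = "\<lambda>i. encode code (drop i w)"
  let ?I = "\<lambda>j m' u'. \<exists>i. i + j = n \<and> m' BIT = next_symbol (?rest i) + 1 \<and> u' = tl (?rest i) \<and>
    m' CUR = loc r i 0 \<and> letters_at {..<i} m' \<and> idents_at {..n} 0 m' \<and> counters (\<lambda>_. 0) m'"
  have rest: "\<exists>b ds. code (w ! i) = b # ds \<and> length ds = k \<and> ?rest i = b # ds @ ?rest (Suc i)"
    if "i < n" for i
  proof -
    obtain b ds where "code (w ! i) = b # ds" "length ds = k"
      using code(2)[OF nth_letter[OF \<open>i < n\<close>]] by (metis length_Suc_conv)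
    then show ?thesis using that by (simp add: encode_def flip: Cons_nth_drop_Suc)
  qed
  show ?thesis
    unfolding read_word_def wp_Seq wp_fetch
  proof (rule wp_Loop[where Inv = ?I and k = n and N = "3 * k + 12"])
    fix j m u' t
    assume "?I (Suc j) m u'"
    then obtain i where I: "i + Suc j = n" "m BIT = next_symbol (?rest i) + 1" "u' = tl (?rest i)"
      "m CUR = loc r i 0" "letters_at {..<i} m" "idents_at {..n} 0 m" "counters (\<lambda>_. 0) m" by blast
    then have i: "i < n" "Suc i + j = n" by auto
    obtain b ds where b: "code (w ! i) = b # ds" "length ds = k" "?rest i = b # ds @ ?rest (Suc i)"
      using rest[OF i(1)] by blast
    let ?R = "store_letter r ;; fetch"
    let ?Q = "\<lambda>(m', u', t'). ?I j m' u' \<and> t' \<le> t + (3 * k + 12)"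
    have R: "wp ?R ?Q (m(BIT := c, GEN := int (fst (w ! i)), SGN := of_bool (snd (w ! i))), ?rest (Suc i), t')"
      if "t' \<le> t + (3 * k + 5)" for c t'
      unfolding wp_Seq
    proof (rule wp_store_letter[where i = i and T = "{..n}" and k = 0 and f = "\<lambda>_. 0"])
      fix m' assume "letters_at {..<Suc i} m'" "idents_at {..n} 0 m'" "counters (\<lambda>_. 0) m'"
        "m' CUR = loc r (Suc i) 0"
      then have "?I j (m'(BIT := next_symbol (?rest (Suc i)) + 1)) (tl (?rest (Suc i)))"
        using i by (intro exI[of _ "Suc i"]) simp
      then show "wp fetch ?Q (m', ?rest (Suc i), t' + 5)" using that by simp
    qed (use I in simp_all)
    have "wp (decode r code (length ds) [b]) (wp ?R ?Q) (m(BIT := of_bool b), ds @ ?rest (Suc i), t + 3)"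
    proof (rule wp_decode[OF code(1) nth_letter[OF i(1)]])
      show "code (w ! i) = [b] @ ds" using b by simp
    next
      fix c t'
      assume "t' \<le> t + 3 + (3 * length ds + 2)"
      then show "wp ?R ?Q ((m(BIT := of_bool b))(BIT := c, GEN := int (fst (w ! i)),
          SGN := of_bool (snd (w ! i))), ?rest (Suc i), t')"
        unfolding fun_upd_upd by (intro R) (use b in simp)
    qed
    moreover have BIT: "m BIT = of_bool b + 1" "u' = ds @ ?rest (Suc i)"
      unfolding I(2,3) b(3) by (simp_all add: next_symbol_def)
    ultimately have "wp (read_letter r code k) ?Q (m, u', t)"
      unfolding b(2) by (intro wp_read_letter[where b = b]) simp_all
    moreover have "holds (IsPos (reg BIT)) m" using BIT(1) by simp
    ultimately show "holds (IsPos (reg BIT)) m \<and> wp (read_letter r code k) ?Q (m, u', t)" by blast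
  next
    have "?I n (m(BIT := next_symbol (encode code w) + 1)) (tl (encode code w))"
      using assms(5) m by (intro exI[of _ 0]) (simp add: letters_at_def idents_at_def counters_def slot_def)
    then show "?I n (m(BIT := next_symbol (encode code w) + 1)) (tl (encode code w))" .
  next
    fix m' u' t'
    assume "?I 0 m' u'" and t': "t' \<le> t + 2 + (n * (3 * k + 12 + 2) + 2)"
    then show "wp (Put (Cell END) (reg CUR) 0) Q (m', u', t')" by (auto intro!: Q simp: algebra_simps)
  next
    fix m' u'
    assume "?I 0 m' u'"
    then have "m' BIT = next_symbol (?rest n) + 1" by auto
    then show "\<not> holds (IsPos (reg BIT)) m'" by (simp add: encode_def next_symbol_def)
  qed
qed

end


section \<open>Running time\<close>

definition solver :: "nat \<Rightarrow> nat \<Rightarrow> (letter \<Rightarrow> bool list) \<Rightarrow> nat \<Rightarrow> com" where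
  "solver r d code k = read_word r code k ;; levels r d"

definition solver_program :: "nat \<Rightarrow> nat \<Rightarrow> (letter \<Rightarrow> bool list) \<Rightarrow> nat \<Rightarrow> program" where
  "solver_program r d code k =
     (let l = code_length (solver r d code k) in
        compile 0 (solver r d code k) @ [JumpIfZero (deref END) (l + 2), Halt False, Halt True])"

definition step_bound :: "nat \<Rightarrow> nat \<Rightarrow> nat \<Rightarrow> nat \<Rightarrow> nat" where
  "step_bound r d k n = n * (3 * k + 14) + 5 + (d * (n * (24 * n + 4 * r + 32) + 6) + 1)"

lemma (in machine_word) wp_solver:
  assumes "inj_on code (letters r)" "\<And>x. x \<in> letters r \<Longrightarrow> length (code x) = Suc k"
  shows "wp (solver r d code k)
    (\<lambda>(m, u, t). (m (m END) = 0 \<longleftrightarrow> w \<in> word_problem r d) \<and> t \<le> step_bound r d k n)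
    (\<lambda>_. 0, encode code w, 0)"
  unfolding solver_def wp_Seq
proof (rule wp_read_word[OF assms])
  fix m u t
  assume m: "letters_at {..<n} m" "idents_at {..n} 0 m" "counters (\<lambda>_. 0) m" "m END = loc r n 0"
    and t: "t \<le> 0 + (n * (3 * k + 14) + 5)"
  show "wp (levels r d)
      (\<lambda>(m, u, t). (m (m END) = 0 \<longleftrightarrow> w \<in> word_problem r d) \<and> t \<le> step_bound r d k n) (m, u, t)"
  proof (rule wp_levels[OF m])
    fix m' t'
    assume "idents_at {..n} d m'" "m' END = loc r n 0"
      "t' \<le> t + (d * (n * (24 * n + 4 * r + 32) + 6) + 1)"
    then show "case (m', u, t') of
        (m, u, t) \<Rightarrow> (m (m END) = 0 \<longleftrightarrow> w \<in> word_problem r d) \<and> t \<le> step_bound r d k n"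
      using t by (simp add: idents_at_def step_bound_def word_problem_iff_ident[OF w])
  qed
qed simp_all

lemma (in machine_word) solver_program_steps:
  assumes "inj_on code (letters r)" "\<And>x. x \<in> letters r \<Longrightarrow> length (code x) = Suc k"
  shows "\<exists>s c. s \<le> step_bound r d k n + 1
    \<and> steps (solver_program r d code k) s (initial (encode code w)) c
    \<and> pc c < length (solver_program r d code k)
    \<and> solver_program r d code k ! pc c = Halt (w \<in> word_problem r d)"
proof -
  let ?c = "solver r d code k" and ?P = "solver_program r d code k"
  let ?l = "code_length ?c"
  obtain m u t where run: "run ?c (\<lambda>_. 0, encode code w, 0) (m, u, t)"
    and t: "t \<le> step_bound r d k n" and m: "m (m END) = 0 \<longleftrightarrow> w \<in> word_problem r d"
    using wp_solver[OF assms, of d] unfolding wp_def by auto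
  let ?end = "[JumpIfZero (deref END) (?l + 2), Halt False, Halt True]"
  have P: "?P = [] @ compile 0 ?c @ ?end" by (simp add: solver_program_def Let_def)
  from compile_correct[OF run P] obtain s where s: "s \<le> t"
    "steps ?P s (config_at 0 (\<lambda>_. 0) (encode code w)) (config_at ?l m u)"
    by auto
  let ?p = "if w \<in> word_problem r d then ?l + 2 else ?l + 1"
  have "steps ?P 1 (config_at ?l m u) (config_at ?p m u)"
  proof (rule steps_one)
    show "?P = compile 0 ?c @ [JumpIfZero (deref END) (?l + 2)] @ [Halt False, Halt True]"
      by (simp add: solver_program_def Let_def)
  qed (use m in \<open>auto simp: jump_if_def\<close>)
  with s(2) have "steps ?P (s + 1) (initial (encode code w)) (config_at ?p m u)"
    unfolding initial_def by (rule steps_trans)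
  moreover have "?P ! ?p = Halt (w \<in> word_problem r d)" "?p < length ?P"
    unfolding P by (auto simp: nth_append)
  ultimately show ?thesis using s(1) t
    by (intro exI[of _ "s + 1"] exI[of _ "config_at ?p m u"]) auto
qed

lemma plain_solver_program:
  assumes "i \<in> set (solver_program r d code k)"
  shows "plain i"
  using assms plain_compile by (auto simp: solver_program_def Let_def)

text \<open>
  \<open>(n + 1)\<^sup>2\<close> instead of \<open>n\<^sup>2\<close> covers the empty word.
\<close>

lemma step_bound_quadratic: "\<exists>C\<ge>1. \<forall>n. step_bound r d k n + 1 \<le> C * (n + 1)^2"
proof (intro exI conjI allI)
  show "1 \<le> 3 * k + 21 + d * (4 * r + 62)" by simp
  fix n :: nat
  have n: "n \<le> (n + 1)^2" "n * n \<le> (n + 1)^2" "1 \<le> (n + 1)^2" by (simp_all add: power2_eq_square)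
  have "step_bound r d k n + 1 = (3 * k + 14) * n + 7 * 1 + d * (24 * (n * n) + (4 * r + 32) * n + 6 * 1)"
    by (simp add: step_bound_def algebra_simps)
  also have "\<dots> \<le> (3 * k + 14) * (n + 1)^2 + 7 * (n + 1)^2
      + d * (24 * (n + 1)^2 + (4 * r + 32) * (n + 1)^2 + 6 * (n + 1)^2)"
    by (intro add_mono mult_le_mono le_refl n)
  also have "\<dots> = (3 * k + 21 + d * (4 * r + 62)) * (n + 1)^2"
    by (simp add: algebra_simps)
  finally show "step_bound r d k n + 1 \<le> (3 * k + 21 + d * (4 * r + 62)) * (n + 1)^2" .
qed

lemma bit_size_le_log: "1 \<le> x \<Longrightarrow> real (bit_size (int x)) \<le> log 2 (real x) + 2"
  by (simp add: bit_size_def floorlog_def)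

text \<open>
  \<open>D\<close> bounds the growth of memory per step, so all numbers are at most \<open>D + S n * D\<close> and their bit
  size is \<open>O(log n)\<close>.
\<close>

lemma quadratic_steps_time:
  assumes S: "\<And>n. S n \<le> C * (n + 1)^2" "1 \<le> C" and D: "1 \<le> D"
  shows "(\<lambda>n. real (S n * (9 * bit_size (int (D + S n * D))) + 1)) \<in> soft_O (\<lambda>n. real n ^ 2)"
proof -
  define c where "c = real C"
  define a where "a = log 2 (2 * real D * c) + 2"
  have c: "c > 0" using S(2) by (simp add: c_def)
  have bound: "real (S n * (9 * bit_size (int (D + S n * D))) + 1)
      \<le> c * (real n + 1)^2 * (9 * (a + 2 * log 2 (real n + 1))) + 1" for n
  proof -
    have Sn: "real (S n) \<le> c * (real n + 1)^2"
      using of_nat_mono[OF S(1)[of n], where 'a = real] by (simp add: c_def add.commute)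
    have "1 \<le> c" using S(2) by (simp add: c_def)
    then have c1: "1 \<le> c * (real n + 1)^2"
      by (simp add: mult_ge1_I)
    have "real D * (1 + real (S n)) \<le> real D * (c * (real n + 1)^2 + c * (real n + 1)^2)"
      using Sn c1 by (intro mult_left_mono add_mono) simp_all
    then have le: "real (D + S n * D) \<le> (2 * real D * c) * (real n + 1)^2"
      by (simp add: algebra_simps)
    have "real (bit_size (int (D + S n * D))) \<le> log 2 (real (D + S n * D)) + 2"
      using D by (intro bit_size_le_log) simp
    also have "log 2 (real (D + S n * D)) \<le> log 2 ((2 * real D * c) * (real n + 1)^2)"
      using le D by (intro log_mono) (simp_all add: add_pos_nonneg)
    also have "\<dots> = log 2 (2 * real D * c) + 2 * log 2 (real n + 1)"
      using D c by (simp add: log_mult log_nat_power)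
    finally have "real (bit_size (int (D + S n * D))) \<le> a + 2 * log 2 (real n + 1)"
      by (simp add: a_def)
    then have "real (S n) * (9 * real (bit_size (int (D + S n * D))))
        \<le> c * (real n + 1)^2 * (9 * (a + 2 * log 2 (real n + 1)))"
      using Sn c1 by (intro mult_mono) auto
    then show ?thesis by simp
  qed
  have "(\<lambda>n. real (S n * (9 * bit_size (int (D + S n * D))) + 1))
      \<in> O(\<lambda>n. c * (real n + 1)^2 * (9 * (a + 2 * log 2 (real n + 1))) + 1)"
  proof (intro landau_o.big_mono always_eventually allI)
    fix n
    show "norm (real (S n * (9 * bit_size (int (D + S n * D))) + 1))
        \<le> norm (c * (real n + 1)^2 * (9 * (a + 2 * log 2 (real n + 1))) + 1)"
      using order_trans[OF bound[of n] abs_ge_self] by (simp only: real_norm_def abs_of_nat)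
  qed
  also have "(\<lambda>n. c * (real n + 1)^2 * (9 * (a + 2 * log 2 (real n + 1))) + 1)
      \<in> O(\<lambda>n. real n ^ 2 * log 2 (real n) ^ 1)"
    using c by real_asymp
  finally show ?thesis unfolding soft_O_def by blast
qed

theorem theorem2p6:
  fixes r d :: nat and code :: "letter \<Rightarrow> bool list"
  assumes "letter_code r code"
  shows "\<exists>P T. decides_in_time P code (words r) (word_problem r d) T \<and>
           (\<lambda>n. real (T n)) \<in> soft_O (\<lambda>n. real n ^ 2)"
proof -
  define k where "k = nat \<lceil>log 2 (real r)\<rceil>"
  define P where "P = solver_program r d code k"
  define S where "S n = step_bound r d k n + 1" for n
  have code: "inj_on code (letters r)" "length (code x) = Suc k" if "x \<in> letters r" for x
    using assms that by (auto simp: letter_code_def k_def)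
  have inj: "inj_on code (letters r)" using assms by (simp add: letter_code_def)
  obtain D where D: "1 \<le> D" "\<forall>i\<in>set P. instr_within D i" using instr_within_exists by blast
  define T where "T n = S n * (9 * bit_size (int (D + S n * D))) + 1" for n
  have "\<exists>t\<le>T (length w). computes P (initial (encode code w)) (w \<in> word_problem r d) t"
    if w: "w \<in> words r" for w
  proof -
    interpret machine_word r w by unfold_locales (rule w)
    obtain s c where s: "s \<le> S (length w)" "steps P s (initial (encode code w)) c"
      "pc c < length P" "P ! pc c = Halt (w \<in> word_problem r d)"
      using solver_program_steps[OF inj code(2), where d = d] by (auto simp: P_def S_def)
    have "bounded_mem D (mem (initial (encode code w)))" by (simp add: bounded_mem_def initial_def)
    moreover have "D + s * D \<le> D + S (length w) * D" using s(1) by simp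
    ultimately have "\<exists>t\<le>s * (9 * bit_size (int (D + S (length w) * D))) + 1.
        computes P (initial (encode code w)) (w \<in> word_problem r d) t"
      using D plain_solver_program
      by (intro computes_of_steps[OF s(2) _ D(1) _ le_refl _ s(3,4)]) (auto simp: P_def)
    moreover have "s * (9 * bit_size (int (D + S (length w) * D))) + 1 \<le> T (length w)"
      unfolding T_def using s(1) by (intro add_mono mult_le_mono1 le_refl)
    ultimately show ?thesis by (meson le_trans)
  qed
  then have "decides_in_time P code (words r) (word_problem r d) T"
    by (simp add: decides_in_time_def)
  moreover obtain C where "C \<ge> 1" "\<forall>n. step_bound r d k n + 1 \<le> C * (n + 1)^2"
    using step_bound_quadratic by blast
  then have "(\<lambda>n. real (T n)) \<in> soft_O (\<lambda>n. real n ^ 2)"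
    unfolding T_def using D(1) by (intro quadratic_steps_time[where C = C]) (auto simp: S_def)
  ultimately show ?thesis by blast
qed

end
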